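(* Let $\mathcal{D}=\{(\mathbf{x}_i,y_i):i=1,\dots,N\}\subset\mathbb{R}^m\times\{\pm1\}$ be a fixed dataset, let $\lambda\ge0$, and suppose $\mathbf{w}^*$ minimizes $$\widehat f(\mathbf{w};\mathcal{D})=\tfrac12\lambda\|\mathbf{w}\|_2^2+\frac1N\sum_{i=1}^N\max(0,1-y_i\mathbf{w}^T\mathbf{x}_i)$$ over $\mathbf{w}\in\mathbb{R}^m$. Suppose that the set $\mathcal{I}=\{i\mid 1=y_i\mathbf{x}_i^T\mathbf{w}^*\}$ has exactly $m$ elements and that the vectors $\mathbf{x}_i$, $i\in\mathcal{I}$, are linearly independent. Assume further that the unique solution $(\theta_i)_{i\in\mathcal{I}}$ of $$\sum_{i\in\mathcal{I}}\theta_iy_i\mathbf{x}_i+\sum_{j\notin\mathcal{I},\ 1>y_j\mathbf{x}_j^T\mathbf{w}^*}y_j\mathbf{x}_j-N\lambda\mathbf{w}^*=\mathbf{0}$$ satisfies $0<\theta_i<1$ for all $i\in\mathcal{I}$. Fix $\beta,c_1\in(0,1)$, $\alpha_{\mathrm{init}}>0$ and $\mathbf{w}_{\mathrm{init}}\in\mathbb{R}^m$, and run the guarded Newton method with decreasing smoothing parameter (defined in the context) with stopping parameter $\eta$. If $\eta\ll1$, then the number of guarded Newton steps needed for each value of $\alpha$ with $\alpha\ll N^{-1}$ is asymptotically independent of $\alpha$ (but may depend on $\beta$ and on $\mathcal{I}$). That is: there is $\eta_0>0$ such that for every $\eta\in(0,\eta_0)$ there exist $\bar\alpha>0$ and an integer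 $n$, independent of $\alpha$, such that for every value $\alpha=\beta^k\alpha_{\mathrm{init}}\le\bar\alpha$ ($k\ge1$) of the smoothing parameter, at most $n$ guarded Newton steps are made with smoothing parameter $\alpha$ before the stopping criterion for $\alpha$ holds.
   Context: With $\psi(u)=\tfrac12\big(u+\sqrt{1+u^2}\big)$ and $\alpha>0$, the smoothed objective is $$\widehat f_\alpha(\mathbf{w};\mathcal{D})=\tfrac12\lambda\|\mathbf{w}\|_2^2+\frac1N\sum_{i=1}^N\alpha\,\psi\!\left(\frac{1-y_i\mathbf{w}^T\mathbf{x}_i}{\alpha}\right).$$ Guarded Newton method with decreasing smoothing parameter (the active-set / $\ell^1$ part of the algorithm is not considered, i.e. all components are active and there is no $\ell^1$ term). Start with $\alpha=\alpha_{\mathrm{init}}$, $\mathbf{w}=\mathbf{w}_{\mathrm{init}}$ and repeat: compute $\mathbf{g}=\nabla\widehat f_\alpha(\mathbf{w};\mathcal{D})$, $H=\operatorname{Hess}\widehat f_\alpha(\mathbf{w};\mathcal{D})$ and the Newton step $\mathbf{d}=-H^{-1}\mathbf{g}$. - Stopping criterion for $\alpha$: if $|\mathbf{d}^T\mathbf{g}|<\eta\alpha$, replace $\alpha$ by $\beta\alpha$, keep $\mathbf{w}$, and continue. - Otherwise perform a guarded Newton step: set $s=1$; while $\widehat f_\alpha(\mathbf{w}+s\mathbf{d};\mathcal{D})>\widehat f_\alpha(\mathbf{w};\mathcal{D})+c_1s\,\mathbf{d}^T\mathbf{g}$ replace $s$ by $s/2$ (Armijo backtracking); then replace $\mathbf{w}$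 by $\mathbf{w}+s\mathbf{d}$. The final sentence of the claim (after "That is") is the meaning of the preceding sentence. *)

theory Defs
  imports "HOL-Analysis.Analysis" "HOL-Library.While_Combinator"
begin

section \<open>Hinge-loss objective and its smoothing\<close>

text \<open>The dataset is the family of pairs of \<open>x i\<close> and \<open>y i\<close> for \<open>i \<in> {1..N}\<close>; the values
  of \<open>x\<close> and \<open>y\<close> at other indices are never used.\<close>

definition hinge_objective ::
  "nat \<Rightarrow> (nat \<Rightarrow> real^'m) \<Rightarrow> (nat \<Rightarrow> real) \<Rightarrow> real \<Rightarrow> real^'m \<Rightarrow> real" where
  "hinge_objective N x y l w =
     1/2 * l * (norm w)\<^sup>2 + 1 / real N * (\<Sum>i=1..N. max 0 (1 - y i * (w \<bullet> x i)))"

definition psi :: "real \<Rightarrow> real" where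
  "psi u = 1/2 * (u + sqrt (1 + u\<^sup>2))"

definition smoothed_objective ::
  "nat \<Rightarrow> (nat \<Rightarrow> real^'m) \<Rightarrow> (nat \<Rightarrow> real) \<Rightarrow> real \<Rightarrow> real \<Rightarrow> real^'m \<Rightarrow> real" where
  "smoothed_objective N x y l \<alpha> w =
     1/2 * l * (norm w)\<^sup>2
       + 1 / real N * (\<Sum>i=1..N. \<alpha> * psi ((1 - y i * (w \<bullet> x i)) / \<alpha>))"


section \<open>Guarded Newton method with decreasing smoothing parameter\<close>

text \<open>\<open>gradient f w\<close> and \<open>hessian f w\<close> are unspecified where \<open>f\<close> is not (twice)
  differentiable, and \<open>matrix_inv\<close> is unspecified on singular matrices.\<close>

definition gradient :: "(real^'m \<Rightarrow> real) \<Rightarrow> real^'m \<Rightarrow> real^'m" where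
  "gradient f w = (THE g. GDERIV f w :> g)"

definition hessian :: "(real^'m \<Rightarrow> real) \<Rightarrow> real^'m \<Rightarrow> real^'m^'m" where
  "hessian f w = jacobian (gradient f) (at w)"

definition newton_direction :: "(real^'m \<Rightarrow> real) \<Rightarrow> real^'m \<Rightarrow> real^'m" where
  "newton_direction f w = - (matrix_inv (hessian f w) *v gradient f w)"

definition backtracking_step_size ::
  "real \<Rightarrow> (real^'m \<Rightarrow> real) \<Rightarrow> real^'m \<Rightarrow> real^'m \<Rightarrow> real" where
  "backtracking_step_size c1 f w d =
     while (\<lambda>s. f (w + s *\<^sub>R d) > f w + c1 * s * (d \<bullet> gradient f w)) (\<lambda>s. s / 2) 1"

definition guarded_newton_step :: "real \<Rightarrow> (real^'m \<Rightarrow> real) \<Rightarrow> real^'m \<Rightarrow> real^'m" where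
  "guarded_newton_step c1 f w =
     (let d = newton_direction f w in w + backtracking_step_size c1 f w d *\<^sub>R d)"

text \<open>In the following, \<open>F \<alpha>\<close> is the objective for the smoothing parameter \<open>\<alpha>\<close>, and a
  state of the method is a pair of the current \<open>\<alpha>\<close> and the current iterate \<open>w\<close>.\<close>

definition stopping_criterion ::
  "(real \<Rightarrow> real^'m \<Rightarrow> real) \<Rightarrow> real \<Rightarrow> real \<times> (real^'m) \<Rightarrow> bool" where
  "stopping_criterion F \<eta> = (\<lambda>(\<alpha>, w).
     \<bar>newton_direction (F \<alpha>) w \<bullet> gradient (F \<alpha>) w\<bar> < \<eta> * \<alpha>)"

definition method_step ::
  "(real \<Rightarrow> real^'m \<Rightarrow> real) \<Rightarrow> real \<Rightarrow> real \<Rightarrow> real \<Rightarrow> real \<times> (real^'m) \<Rightarrow> real \<times> (real^'m)" where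
  "method_step F \<beta> c1 \<eta> = (\<lambda>(\<alpha>, w).
     if stopping_criterion F \<eta> (\<alpha>, w) then (\<beta> * \<alpha>, w)
     else (\<alpha>, guarded_newton_step c1 (F \<alpha>) w))"

definition method_run ::
  "(real \<Rightarrow> real^'m \<Rightarrow> real) \<Rightarrow> real \<Rightarrow> real \<Rightarrow> real \<Rightarrow> real \<times> (real^'m) \<Rightarrow> nat \<Rightarrow> real \<times> (real^'m)" where
  "method_run F \<beta> c1 \<eta> init t = (method_step F \<beta> c1 \<eta> ^^ t) init"

text \<open>The stopping criterion for \<open>\<alpha>\<close> is eventually reached in the run, after at most \<open>n\<close>
  guarded Newton steps with smoothing parameter \<open>\<alpha>\<close>.  The index \<open>t\<close> of the run also counts
  the reductions of the smoothing parameter, so the Newton steps are counted explicitly.\<close>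

definition stops_within ::
  "(real \<Rightarrow> real^'m \<Rightarrow> real) \<Rightarrow> real \<Rightarrow> real \<Rightarrow> real \<Rightarrow> real \<times> (real^'m) \<Rightarrow> real \<Rightarrow> nat \<Rightarrow> bool" where
  "stops_within F \<beta> c1 \<eta> init \<alpha> n \<longleftrightarrow>
     (\<exists>T. fst (method_run F \<beta> c1 \<eta> init T) = \<alpha> \<and>
          stopping_criterion F \<eta> (method_run F \<beta> c1 \<eta> init T) \<and>
          card {t. t < T \<and> fst (method_run F \<beta> c1 \<eta> init t) = \<alpha> \<and>
                   \<not> stopping_criterion F \<eta> (method_run F \<beta> c1 \<eta> init t)} \<le> n)"

end

theory Submission
  imports Defs
begin

text \<open>
  Write \<open>f\<close> for the hinge objective and \<open>F \<alpha>\<close> for its smoothing.  Everything happens on the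
  length scale \<open>\<alpha>\<close> around \<open>wstar\<close>: in the coordinates \<open>(w - wstar) / \<alpha>\<close>, the functions
  \<open>F \<alpha> / \<alpha>\<close> are coercive and locally well conditioned uniformly for \<open>\<alpha> \<le> \<alpha>init\<close>, and the
  method is invariant under this rescaling.  The proof works with this scaling of the
  constants but keeps the original coordinates.

  Coercivity comes from nondegeneracy.  Because the multipliers \<open>\<theta> i\<close> lie strictly between
  \<open>0\<close> and \<open>1\<close> and the active \<open>x i\<close> form a basis, \<open>f\<close> grows at least like
  \<open>c * norm (w - wstar)\<close> (lemma \<open>sharp_minimum\<close>).  Since
  \<open>f \<le> F \<alpha> \<le> f + \<alpha> / 2\<close>, a sublevel set of \<open>F \<alpha>\<close> of height \<open>O(\<alpha>)\<close> lies within distance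
  \<open>O(\<alpha>)\<close> of \<open>wstar\<close>.  There the curvature of \<open>F \<alpha>\<close> is between \<open>\<mu> / \<alpha>\<close> and \<open>K / \<alpha>\<close>
  (lemmas \<open>smoothed_hessian_ge\<close> and \<open>smoothed_hessian_le\<close>; the upper bound holds globally).

  Number of steps of one stage.  Armijo backtracking accepts a step size bounded below in
  terms of \<open>\<mu> / K\<close>, so each step made while the decrement is at least \<open>\<eta> * \<alpha>\<close> lowers
  \<open>F \<alpha>\<close> by a fixed multiple of \<open>\<eta> * \<alpha>\<close> (lemma \<open>guarded_newton_step_decrease\<close>).  If the
  stage starts at distance \<open>O(\<alpha>)\<close> from \<open>wstar\<close>, only \<open>O(\<alpha>)\<close> can be lost, and the number of
  steps is bounded independently of \<open>\<alpha>\<close> (lemma \<open>stage_ends_uniformly\<close>).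

  Start of a stage.  It begins where the stopping criterion held for the preceding value
  of \<open>\<alpha>\<close>.  For \<open>\<eta>\<close> small this forces distance \<open>O(\<alpha>)\<close>: far from \<open>wstar\<close> the slope of
  \<open>F \<alpha>\<close> is bounded away from \<open>0\<close> by convexity and the curvature is at most \<open>K / \<alpha>\<close>, so the
  decrement is at least a fixed multiple of \<open>\<alpha>\<close> (lemma \<open>stopping_criterion_near_vertex\<close>).
  Passing from \<open>\<alpha>\<close> to \<open>\<beta> * \<alpha>\<close> costs only the constant factor \<open>1 / \<beta>\<close>.  The same bound on
  the number of steps, with a constant depending on the initial point, shows that the stage
  of \<open>\<alpha>init\<close> ends as well, so that every later value of \<open>\<alpha>\<close> is reached.
\<close>


section \<open>The smoothed hinge function\<close>

definition psi_deriv :: "real \<Rightarrow> real" where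
  "psi_deriv u = (1 + u / sqrt (1 + u\<^sup>2)) / 2"

definition psi_deriv2 :: "real \<Rightarrow> real" where
  "psi_deriv2 u = 1 / (2 * sqrt (1 + u\<^sup>2) ^ 3)"

lemma one_plus_square_pos: "0 < 1 + (u::real)\<^sup>2"
  by (simp add: add_pos_nonneg)

lemma DERIV_sqrt_one_plus_square:
  "((\<lambda>u. sqrt (1 + u\<^sup>2)) has_real_derivative u / sqrt (1 + u\<^sup>2)) (at u)"
proof -
  have "((\<lambda>u. 1 + u\<^sup>2) has_real_derivative 2 * u) (at u)"
    by (auto intro!: derivative_eq_intros)
  from DERIV_chain2[OF DERIV_real_sqrt[OF one_plus_square_pos] this] show ?thesis
    by (rule DERIV_cong) (simp add: inverse_eq_divide)
qed

lemma DERIV_psi: "(psi has_real_derivative psi_deriv u) (at u)"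
proof -
  have "((\<lambda>u. 1/2 * (u + sqrt (1 + u\<^sup>2))) has_real_derivative 1/2 * (1 + u / sqrt (1 + u\<^sup>2))) (at u)"
    by (intro DERIV_cmult DERIV_add DERIV_ident DERIV_sqrt_one_plus_square)
  then show ?thesis
    by (simp add: psi_def[abs_def] psi_deriv_def)
qed

lemma DERIV_psi_deriv: "(psi_deriv has_real_derivative psi_deriv2 u) (at u)"
proof -
  define r where "r = sqrt (1 + u\<^sup>2)"
  have r: "r > 0" "r * r = 1 + u\<^sup>2"
    using one_plus_square_pos[of u] by (auto simp: r_def)
  have "((\<lambda>u. u / sqrt (1 + u\<^sup>2)) has_real_derivative (1 * r - u * (u / r)) / (r * r)) (at u)"
    unfolding r_def
    by (rule DERIV_divide[OF DERIV_ident DERIV_sqrt_one_plus_square]) (use r(1) in \<open>simp add: r_def\<close>)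
  from DERIV_cdivide[OF DERIV_add[OF DERIV_const this], of 1 2]
  have "((\<lambda>u. (1 + u / sqrt (1 + u\<^sup>2)) / 2) has_real_derivative
      ((r - u * (u / r)) / (r * r)) / 2) (at u)"
    by simp
  moreover have "((r - u * (u / r)) / (r * r)) / 2 = psi_deriv2 u"
  proof -
    have "r - u * (u / r) = (r * r - u\<^sup>2) / r"
      using r(1) by (simp add: field_simps power2_eq_square)
    also have "\<dots> = 1 / r"
      using r(2) by simp
    finally show ?thesis
      using r(1) by (simp add: psi_deriv2_def r_def[symmetric] power3_eq_cube)
  qed
  ultimately show ?thesis
    by (simp add: psi_deriv_def[abs_def])
qed

lemma abs_psi_deriv_le: "\<bar>psi_deriv u\<bar> \<le> 1"
proof -
  define v where "v = u / sqrt (1 + u\<^sup>2)"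
  have "\<bar>u\<bar> \<le> sqrt (1 + u\<^sup>2)"
    by (rule real_le_rsqrt) simp
  then have "\<bar>v\<bar> \<le> 1"
    using one_plus_square_pos[of u] by (simp add: v_def abs_divide)
  then show ?thesis
    unfolding psi_deriv_def v_def[symmetric] by simp
qed

lemma one_le_sqrt_one_plus_square: "1 \<le> sqrt (1 + (u::real)\<^sup>2)"
  by simp

lemma psi_deriv2_pos: "0 < psi_deriv2 u"
  using one_plus_square_pos[of u] by (simp add: psi_deriv2_def)

lemma psi_deriv2_le: "psi_deriv2 u \<le> 1/2"
proof -
  have "1 \<le> sqrt (1 + u\<^sup>2) ^ 3"
    by (rule one_le_power[OF one_le_sqrt_one_plus_square])
  then show ?thesis
    unfolding psi_deriv2_def by (intro divide_left_mono) (use one_plus_square_pos[of u] in auto)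
qed

lemma psi_deriv2_antimono:
  assumes "\<bar>u\<bar> \<le> R"
  shows "psi_deriv2 R \<le> psi_deriv2 u"
proof -
  have "u\<^sup>2 \<le> R\<^sup>2"
    using assms abs_le_square_iff[of u R] by simp
  then have "sqrt (1 + u\<^sup>2) ^ 3 \<le> sqrt (1 + R\<^sup>2) ^ 3"
    by (intro power_mono) auto
  moreover have "0 < sqrt (1 + u\<^sup>2) ^ 3"
    using one_plus_square_pos[of u] by simp
  ultimately show ?thesis
    unfolding psi_deriv2_def by (intro divide_left_mono mult_pos_pos) auto
qed

lemma hinge_le_psi: "max 0 u \<le> psi u"
proof -
  define r where "r = sqrt (1 + u\<^sup>2)"
  have "\<bar>u\<bar> \<le> r"
    unfolding r_def by (rule real_le_rsqrt) simp
  then show ?thesis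
    unfolding psi_def r_def[symmetric] by simp
qed

lemma psi_le_hinge: "psi u \<le> max 0 u + 1/2"
proof -
  define r where "r = sqrt (1 + u\<^sup>2)"
  have "r \<le> 1 + \<bar>u\<bar>"
    unfolding r_def by (rule real_le_lsqrt) (auto simp: power2_eq_square algebra_simps)
  then show ?thesis
    unfolding psi_def r_def[symmetric] by (cases "u \<ge> 0") auto
qed

text \<open>With \<open>r = sqrt (1 + z\<^sup>2)\<close> the claim is \<open>1 + z * (z + t) \<le> r * sqrt (1 + (z + t)\<^sup>2)\<close>,
  the Cauchy--Schwarz inequality for the vectors \<open>(1, z)\<close> and \<open>(1, z + t)\<close>.\<close>

lemma psi_above_tangent: "psi z + psi_deriv z * t \<le> psi (z + t)"
proof -
  define r where "r = sqrt (1 + z\<^sup>2)"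
  define s where "s = sqrt (1 + (z + t)\<^sup>2)"
  have r: "r > 0" "r * r = 1 + z\<^sup>2"
    using one_plus_square_pos[of z] by (auto simp: r_def)
  have "(1 + z * (z + t))\<^sup>2 + t\<^sup>2 = (1 + z\<^sup>2) * (1 + (z + t)\<^sup>2)"
    by (simp add: power2_eq_square algebra_simps)
  then have "1 + z * (z + t) \<le> sqrt ((1 + z\<^sup>2) * (1 + (z + t)\<^sup>2))"
    by (intro real_le_rsqrt) (metis le_add_same_cancel1 zero_le_power2)
  then have "r * r + z * t \<le> r * s"
    unfolding r(2) real_sqrt_mult r_def[symmetric] s_def[symmetric]
    by (simp add: power2_eq_square distrib_left)
  then have le: "r + z / r * t \<le> s"
    using r(1) by (simp add: field_simps)
  define q where "q = z / r"
  have "psi z + psi_deriv z * t = 1/2 * (z + t + (r + q * t))"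
    unfolding psi_def psi_deriv_def r_def[symmetric] q_def[symmetric] by (simp add: field_simps)
  with le show ?thesis
    by (simp add: psi_def s_def q_def)
qed

text \<open>The arithmetic--geometric mean inequality \<open>2 * r * s \<le> r\<^sup>2 + s\<^sup>2\<close> for
  \<open>r = sqrt (1 + z\<^sup>2)\<close> and \<open>s = sqrt (1 + (z + t)\<^sup>2)\<close>, together with \<open>r \<ge> 1\<close>.\<close>

lemma psi_below_parabola: "psi (z + t) \<le> psi z + psi_deriv z * t + t\<^sup>2 / 4"
proof -
  define r where "r = sqrt (1 + z\<^sup>2)"
  define s where "s = sqrt (1 + (z + t)\<^sup>2)"
  have r: "r \<ge> 1" "r * r = 1 + z\<^sup>2"
    using one_plus_square_pos[of z] by (auto simp: r_def)
  have s: "s * s = 1 + (z + t)\<^sup>2"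
    using one_plus_square_pos[of "z + t"] by (auto simp: s_def)
  have "0 \<le> (r - s)\<^sup>2"
    by simp
  then have "2 * r * s \<le> 2 * (r * r) + 2 * z * t + t\<^sup>2"
    using r(2) s by (simp add: power2_eq_square algebra_simps)
  then have "s \<le> (2 * (r * r) + 2 * z * t + t\<^sup>2) / (2 * r)"
    using r(1) by (simp add: pos_le_divide_eq mult.commute mult.left_commute)
  also have "\<dots> = r + z / r * t + t\<^sup>2 / (2 * r)"
    using r(1) by (simp add: add_divide_distrib)
  also have "t\<^sup>2 / (2 * r) \<le> t\<^sup>2 / 2"
    using r(1) by (intro divide_left_mono) auto
  finally have le: "s \<le> r + z / r * t + t\<^sup>2 / 2"
    by simp
  define q where "q = z / r"
  have "psi z + psi_deriv z * t + t\<^sup>2 / 4 = 1/2 * (z + t + (r + q * t + t\<^sup>2 / 2))"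
    unfolding psi_def psi_deriv_def r_def[symmetric] q_def[symmetric] by (simp add: field_simps)
  with le show ?thesis
    by (simp add: psi_def s_def q_def)
qed


section \<open>Guarded Newton steps\<close>

lemma gradient_eqI:
  assumes "\<And>w. GDERIV f w :> g w"
  shows "gradient f = g"
proof
  fix w
  show "gradient f w = g w"
    unfolding gradient_def
  proof (rule the_equality)
    fix h
    assume "GDERIV f w :> h"
    then have "(\<lambda>v. v \<bullet> h) = (\<lambda>v. v \<bullet> g w)"
      using assms[of w] unfolding gderiv_def by (rule has_derivative_unique)
    then show "h = g w"
      by (metis vector_eq_ldot)
  qed (rule assms)
qed

lemma newton_direction_solves:
  assumes grad: "\<And>v. GDERIV f v :> g v"
    and hess: "(g has_derivative H) (at w)"
    and pos: "\<And>p. p \<noteq> 0 \<Longrightarrow> 0 < p \<bullet> H p"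
  shows "H (newton_direction f w) = - g w"
proof -
  have lin: "linear H"
    using hess has_derivative_linear by blast
  have hf: "hessian f w = matrix H"
    unfolding hessian_def gradient_eqI[OF grad] jacobian_def
    using hess frechet_derivative_at by metis
  have "Vector_Spaces.linear (*s) (*s) H"
    using lin unfolding linear_def scalar_mult_eq_scaleR[abs_def] .
  then have mult: "matrix H *v p = H p" for p
    by (rule matrix_works)
  have "inj H"
    using pos lin unfolding linear_injective_0[OF lin] by (metis inner_zero_right less_irrefl)
  then have "inj ((*v) (matrix H))"
    unfolding mult .
  then have "invertible (matrix H)"
    by (simp add: invertible_left_inverse matrix_left_invertible_injective)
  then have "matrix H ** matrix_inv (matrix H) = mat 1"
    unfolding invertible_def matrix_inv_def by (rule someI_ex[THEN conjunct1])
  then have "matrix H *v (matrix_inv (matrix H) *v v) = v" for v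
    by (simp add: matrix_vector_mul_assoc)
  then show ?thesis
    unfolding newton_direction_def hf gradient_eqI[OF grad]
    by (metis mult lin linear_neg)
qed

text \<open>Halving starts at \<open>1\<close> and cannot go on once \<open>s\<close> has fallen below a threshold under
  which every step size is acceptable, so it overshoots the threshold by at most a factor
  of two.\<close>

lemma halving_loop:
  fixes b :: "real \<Rightarrow> bool"
  assumes \<sigma>: "0 < \<sigma>"
    and ok: "\<And>s. 0 < s \<Longrightarrow> s \<le> \<sigma> \<Longrightarrow> \<not> b s"
  shows "min 1 (\<sigma> / 2) \<le> while b (\<lambda>s. s / 2) 1 \<and> \<not> b (while b (\<lambda>s. s / 2) 1)"
proof (rule while_rule[where P = "\<lambda>s. min 1 (\<sigma> / 2) \<le> s"
      and r = "Wellfounded.measure (\<lambda>s. nat \<lfloor>s / (\<sigma> / 2)\<rfloor>)"])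
  fix s
  assume s: "min 1 (\<sigma> / 2) \<le> s" "b s"
  then have "s > 0"
    using \<sigma> by linarith
  with ok s have large: "s > \<sigma>"
    by force
  then show "min 1 (\<sigma> / 2) \<le> s / 2"
    by linarith
  \<comment> \<open>Each halving removes at least \<open>\<sigma> / 2\<close>.\<close>
  have "s / 2 / (\<sigma> / 2) + 1 \<le> s / (\<sigma> / 2)"
    using large \<sigma> by (simp add: field_simps)
  moreover have "0 \<le> s / 2 / (\<sigma> / 2)"
    using \<open>s > 0\<close> \<sigma> by simp
  ultimately show "(s / 2, s) \<in> Wellfounded.measure (\<lambda>s. nat \<lfloor>s / (\<sigma> / 2)\<rfloor>)"
    by (simp only: in_measure) linarith
qed auto

text \<open>For the Newton direction \<open>d\<close> the decrement \<open>\<bar>d \<bullet> g\<bar>\<close> equals \<open>d \<bullet> H d\<close> and is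
  at least \<open>\<mu> * (norm d)\<^sup>2\<close>.  The quadratic upper bound then accepts every step size up
  to \<open>2 * \<mu> * (1 - c1) / K\<close>, so backtracking keeps the full step or at least half of
  this size.  Only the ratio of \<open>\<mu>\<close> and \<open>K\<close> enters, which is what makes the estimate
  uniform in the smoothing parameter.\<close>

lemma guarded_newton_step_decrease:
  assumes grad: "\<And>v. GDERIV f v :> g v"
    and hess: "(g has_derivative H) (at w)"
    and \<mu>: "0 < \<mu>" and lower: "\<And>p. \<mu> * (norm p)\<^sup>2 \<le> p \<bullet> H p"
    and K: "0 < K" and upper: "\<And>p. f (w + p) \<le> f w + p \<bullet> g w + K / 2 * (norm p)\<^sup>2"
    and c1: "0 < c1" "c1 < 1"
  shows "f (guarded_newton_step c1 f w)
    \<le> f w - c1 * min 1 (\<mu> * (1 - c1) / K) * \<bar>newton_direction f w \<bullet> gradient f w\<bar>"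
proof -
  define d where "d = newton_direction f w"
  define \<sigma> where "\<sigma> = 2 * \<mu> * (1 - c1) / K"
  define s where "s = backtracking_step_size c1 f w d"
  have \<sigma>: "\<sigma> > 0"
    using \<mu> K c1 by (simp add: \<sigma>_def)
  have "0 < p \<bullet> H p" if "p \<noteq> 0" for p
    using lower[of p] \<mu> that by (smt (verit) mult_pos_pos zero_less_norm_iff zero_less_power)
  then have Hd: "H d = - g w"
    unfolding d_def using newton_direction_solves grad hess by blast
  have dec: "\<mu> * (norm d)\<^sup>2 \<le> - (d \<bullet> g w)"
    using lower[of d] by (simp add: Hd)
  then have nonneg: "0 \<le> - (d \<bullet> g w)"
    using \<mu> by (smt (verit) mult_nonneg_nonneg zero_le_power2)
  have armijo: "\<not> f (w + r *\<^sub>R d) > f w + c1 * r * (d \<bullet> g w)" if r: "0 < r" "r \<le> \<sigma>" for r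
  proof -
    have "K / 2 * r \<le> (1 - c1) * \<mu>"
      using r(2) K by (simp add: \<sigma>_def field_simps)
    then have "K / 2 * r * (norm d)\<^sup>2 \<le> (1 - c1) * \<mu> * (norm d)\<^sup>2"
      by (rule mult_right_mono) simp
    also have "\<dots> \<le> (1 - c1) * - (d \<bullet> g w)"
      using dec c1 mult_left_mono[of "\<mu> * (norm d)\<^sup>2" "- (d \<bullet> g w)" "1 - c1"]
      by (simp add: mult.assoc)
    finally have "r * (K / 2 * r * (norm d)\<^sup>2) \<le> r * ((1 - c1) * - (d \<bullet> g w))"
      using r(1) by (intro mult_left_mono) auto
    moreover have "f (w + r *\<^sub>R d) \<le> f w + r * (d \<bullet> g w) + K / 2 * (r\<^sup>2 * (norm d)\<^sup>2)"
      using upper[of "r *\<^sub>R d"] by (simp add: power_mult_distrib)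
    ultimately show ?thesis
      by (simp add: algebra_simps power2_eq_square)
  qed
  have s: "min 1 (\<sigma> / 2) \<le> s" "\<not> f (w + s *\<^sub>R d) > f w + c1 * s * (d \<bullet> g w)"
    unfolding s_def backtracking_step_size_def gradient_eqI[OF grad]
    using halving_loop[where b = "\<lambda>s. f (w + s *\<^sub>R d) > f w + c1 * s * (d \<bullet> g w)", OF \<sigma> armijo]
    by blast+
  have "c1 * min 1 (\<sigma> / 2) * - (d \<bullet> g w) \<le> c1 * s * - (d \<bullet> g w)"
    using s(1) c1 nonneg by (intro mult_right_mono mult_left_mono) auto
  then show ?thesis
    using s(2) nonneg
    unfolding guarded_newton_step_def Let_def gradient_eqI[OF grad] d_def[symmetric] s_def[symmetric]
    by (simp add: \<sigma>_def mult.assoc)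
qed

text \<open>This is the Cauchy--Schwarz inequality for the inner product \<open>(p, q) \<mapsto> p \<bullet> H q\<close>,
  applied to \<open>p\<close> and the Newton direction.  It turns a small decrement into a small slope
  in any chosen direction \<open>p\<close>.\<close>

lemma slope_le_newton_decrement:
  assumes grad: "\<And>v. GDERIV f v :> g v"
    and hess: "(g has_derivative H) (at w)"
    and pos: "\<And>p. p \<noteq> 0 \<Longrightarrow> 0 < p \<bullet> H p"
    and sym: "\<And>p q. p \<bullet> H q = q \<bullet> H p"
  shows "(p \<bullet> g w)\<^sup>2 \<le> \<bar>newton_direction f w \<bullet> gradient f w\<bar> * (p \<bullet> H p)"
proof (cases "p = 0")
  case False
  define d where "d = newton_direction f w"
  have lin: "linear H"
    using hess has_derivative_linear by blast
  have Hd: "H d = - g w"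
    unfolding d_def using newton_direction_solves[OF grad hess pos] .
  define a b c where "a = p \<bullet> H p" and "b = p \<bullet> H d" and "c = d \<bullet> H d"
  have a: "a > 0"
    using pos[OF False] by (simp add: a_def)
  \<comment> \<open>The discriminant argument: \<open>a *\<^sub>R d - b *\<^sub>R p\<close> is orthogonal to \<open>p\<close> for this inner product.\<close>
  have "0 \<le> (a *\<^sub>R d - b *\<^sub>R p) \<bullet> H (a *\<^sub>R d - b *\<^sub>R p)"
    using pos[of "a *\<^sub>R d - b *\<^sub>R p"] by (cases "a *\<^sub>R d - b *\<^sub>R p = 0") auto
  also have "\<dots> = a * (a * c - b * b)"
    using sym[of d p]
    by (simp add: linear_diff[OF lin] linear_scale[OF lin] inner_diff_left inner_diff_right
        a_def b_def c_def algebra_simps)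
  finally have "b\<^sup>2 \<le> c * a"
    using a by (simp add: zero_le_mult_iff power2_eq_square mult.commute)
  moreover have "c \<le> \<bar>d \<bullet> g w\<bar>"
    by (simp add: c_def Hd)
  ultimately have "b\<^sup>2 \<le> \<bar>d \<bullet> g w\<bar> * a"
    using a by (meson less_imp_le mult_right_mono order_trans)
  moreover have "b = - (p \<bullet> g w)"
    by (simp add: b_def Hd)
  ultimately show ?thesis
    by (simp add: a_def d_def[symmetric] gradient_eqI[OF grad])
qed simp


section \<open>Stages of the method\<close>

text \<open>Among the first \<open>j\<close> steps of the run none changes \<open>\<alpha>\<close>, so all of them are Newton
  steps and \<open>n\<close> bounds their number.\<close>

definition stage_ends_within ::
  "(real \<Rightarrow> real^'m \<Rightarrow> real) \<Rightarrow> real \<Rightarrow> real \<Rightarrow> real \<Rightarrow> real \<Rightarrow> real^'m \<Rightarrow> nat \<Rightarrow> bool" where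
  "stage_ends_within F \<beta> c1 \<eta> \<alpha> w n \<longleftrightarrow>
     (\<exists>j\<le>n. (\<forall>i\<le>j. fst (method_run F \<beta> c1 \<eta> (\<alpha>, w) i) = \<alpha>) \<and>
        stopping_criterion F \<eta> (method_run F \<beta> c1 \<eta> (\<alpha>, w) j))"

lemma method_run_0: "method_run F \<beta> c1 \<eta> init 0 = init"
  by (simp add: method_run_def)

lemma method_run_Suc:
  "method_run F \<beta> c1 \<eta> init (Suc t) = method_step F \<beta> c1 \<eta> (method_run F \<beta> c1 \<eta> init t)"
  by (simp add: method_run_def)

lemma method_run_add:
  "method_run F \<beta> c1 \<eta> init (t + j) = method_run F \<beta> c1 \<eta> (method_run F \<beta> c1 \<eta> init t) j"
  by (simp add: method_run_def add.commute[of t j] funpow_add)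

text \<open>Every Newton step uses up at least \<open>\<epsilon>\<close> of the distance between the initial
  objective value and a lower bound \<open>B\<close>.  The decrease is only required on the initial
  sublevel set, which the iterates never leave.\<close>

lemma stage_ends_by_decrease:
  assumes decr: "\<And>v. F \<alpha> v \<le> F \<alpha> w \<Longrightarrow> \<not> stopping_criterion F \<eta> (\<alpha>, v) \<Longrightarrow>
      F \<alpha> (guarded_newton_step c1 (F \<alpha>) v) \<le> F \<alpha> v - \<epsilon>"
    and bound: "\<And>v. B \<le> F \<alpha> v"
    and \<epsilon>: "0 < \<epsilon>"
    and n: "F \<alpha> w - B < real n * \<epsilon>"
  shows "stage_ends_within F \<beta> c1 \<eta> \<alpha> w n"
proof -
  let ?run = "method_run F \<beta> c1 \<eta> (\<alpha>, w)"
  let ?stop = "stopping_criterion F \<eta>"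
  have run: "\<exists>v. ?run j = (\<alpha>, v) \<and> F \<alpha> v \<le> F \<alpha> w - real j * \<epsilon>" if "\<forall>i<j. \<not> ?stop (?run i)" for j
    using that
  proof (induction j)
    case 0
    then show ?case
      by (simp add: method_run_0)
  next
    case (Suc j)
    then obtain v where v: "?run j = (\<alpha>, v)" "F \<alpha> v \<le> F \<alpha> w - real j * \<epsilon>"
      by auto
    have ns: "\<not> ?stop (\<alpha>, v)"
      using Suc.prems v(1) by (metis lessI)
    have "0 \<le> real j * \<epsilon>"
      using \<epsilon> by simp
    with v(2) have "F \<alpha> v \<le> F \<alpha> w"
      by linarith
    from decr[OF this ns] v(2)
    have "F \<alpha> (guarded_newton_step c1 (F \<alpha>) v) \<le> F \<alpha> w - real (Suc j) * \<epsilon>"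
      by (simp add: algebra_simps)
    then show ?case
      using ns v(1) by (simp add: method_run_Suc method_step_def)
  qed
  have "\<exists>j\<le>n. ?stop (?run j)"
  proof (rule ccontr)
    assume "\<not> ?thesis"
    then obtain v where "F \<alpha> v \<le> F \<alpha> w - real n * \<epsilon>"
      using run[of n] by auto
    then show False
      using bound[of v] n by linarith
  qed
  then obtain j0 where j0: "j0 \<le> n" "?stop (?run j0)"
    by blast
  define j where "j = (LEAST j. ?stop (?run j))"
  have j: "?stop (?run j)" "j \<le> n"
    unfolding j_def using j0 LeastI Least_le order_trans by (metis (no_types, lifting))+
  have "\<not> ?stop (?run i)" if "i < j" for i
    using that not_less_Least unfolding j_def by blast
  then have "fst (?run i) = \<alpha>" if "i \<le> j" for i
    using run[of i] that by auto
  with j show ?thesis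
    unfolding stage_ends_within_def by blast
qed

text \<open>The stages follow each other with strictly decreasing \<open>\<alpha>\<close>, so no Newton step outside
  of a stage is counted for its value of \<open>\<alpha>\<close>.  A stage inherits from the preceding one
  only a point at which the preceding stopping criterion holds.\<close>

lemma stops_within_if_stages_end:
  fixes F :: "real \<Rightarrow> real^'m \<Rightarrow> real"
  assumes \<beta>: "0 < \<beta>" "\<beta> < 1" and init: "0 < \<alpha>init"
    and first: "stage_ends_within F \<beta> c1 \<eta> \<alpha>init winit n0"
    and later: "\<And>k w. stopping_criterion F \<eta> (\<beta> ^ k * \<alpha>init, w) \<Longrightarrow>
      stage_ends_within F \<beta> c1 \<eta> (\<beta> ^ Suc k * \<alpha>init) w n"
    and k: "1 \<le> k"
  shows "stops_within F \<beta> c1 \<eta> (\<alpha>init, winit) (\<beta> ^ k * \<alpha>init) n"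
proof -
  let ?run = "method_run F \<beta> c1 \<eta> (\<alpha>init, winit)"
  let ?stop = "stopping_criterion F \<eta>"
  define begins where "begins k t w \<longleftrightarrow>
    ?run t = (\<beta> ^ k * \<alpha>init, w) \<and> (\<forall>i<t. fst (?run i) > \<beta> ^ k * \<alpha>init)" for k t w
  have ends: "\<exists>j\<le>n. (\<forall>i\<le>j. fst (?run (t + i)) = \<beta> ^ k * \<alpha>init) \<and> ?stop (?run (t + j))"
    if "begins k t w" "stage_ends_within F \<beta> c1 \<eta> (\<beta> ^ k * \<alpha>init) w n" for k t w n
    using that unfolding begins_def stage_ends_within_def method_run_add by auto
  have "\<exists>t w. begins (Suc k) t w \<and> ?stop (\<beta> ^ k * \<alpha>init, w)" for k
  proof -
    have next_stage: "\<exists>t w. begins (Suc k) t w \<and> ?stop (\<beta> ^ k * \<alpha>init, w)"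
      if b: "begins k t w" and e: "stage_ends_within F \<beta> c1 \<eta> (\<beta> ^ k * \<alpha>init) w n" for k t w n
    proof -
      obtain j where j: "\<And>i. i \<le> j \<Longrightarrow> fst (?run (t + i)) = \<beta> ^ k * \<alpha>init" "?stop (?run (t + j))"
        using ends[OF b e] by blast
      obtain v where v: "?run (t + j) = (\<beta> ^ k * \<alpha>init, v)"
        using j(1)[of j] by (metis order_refl prod.collapse)
      have less: "\<beta> ^ Suc k * \<alpha>init < \<beta> ^ k * \<alpha>init"
        using \<beta> init by simp
      have "fst (?run i) \<ge> \<beta> ^ k * \<alpha>init" if "i \<le> t + j" for i
      proof (cases "i < t")
        case True
        then show ?thesis
          using b unfolding begins_def by (simp add: less_imp_le)
      next
        case False
        then show ?thesis
          using j(1)[of "i - t"] that by simp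
      qed
      then have "\<forall>i < Suc (t + j). fst (?run i) > \<beta> ^ Suc k * \<alpha>init"
        using less by (meson less_Suc_eq_le less_le_trans)
      moreover have "?run (Suc (t + j)) = (\<beta> ^ Suc k * \<alpha>init, v)"
        using j(2) v by (simp add: method_run_Suc method_step_def mult.assoc)
      ultimately show ?thesis
        using j(2) v unfolding begins_def by metis
    qed
    show ?thesis
    proof (induction k)
      case 0
      have "begins 0 0 winit"
        by (simp add: begins_def method_run_0)
      then show ?case
        using next_stage first by (metis mult_1 power_0)
    next
      case (Suc k)
      then show ?case
        using next_stage later by blast
    qed
  qed
  then obtain t w where b: "begins k t w" and "stage_ends_within F \<beta> c1 \<eta> (\<beta> ^ k * \<alpha>init) w n"
    using later k by (metis Suc_le_D One_nat_def)
  then obtain j where j: "j \<le> n" "\<forall>i\<le>j. fst (?run (t + i)) = \<beta> ^ k * \<alpha>init" "?stop (?run (t + j))"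
    using ends by blast
  have "{i. i < t + j \<and> fst (?run i) = \<beta> ^ k * \<alpha>init \<and> \<not> ?stop (?run i)} \<subseteq> {t..<t + j}"
    using b unfolding begins_def by (auto simp: not_less[symmetric])
  then have "card {i. i < t + j \<and> fst (?run i) = \<beta> ^ k * \<alpha>init \<and> \<not> ?stop (?run i)} \<le> j"
    using card_mono[of "{t..<t + j}"] by fastforce
  then show ?thesis
    unfolding stops_within_def using j by (meson order_refl order_trans)
qed


section \<open>Derivatives of the smoothed objective\<close>

definition smoothed_gradient ::
  "nat \<Rightarrow> (nat \<Rightarrow> real^'m) \<Rightarrow> (nat \<Rightarrow> real) \<Rightarrow> real \<Rightarrow> real \<Rightarrow> real^'m \<Rightarrow> real^'m" where
  "smoothed_gradient N x y l \<alpha> w =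
     l *\<^sub>R w - (1 / real N) *\<^sub>R
       (\<Sum>i=1..N. (psi_deriv ((1 - y i * (w \<bullet> x i)) / \<alpha>) * y i) *\<^sub>R x i)"

definition smoothed_hessian ::
  "nat \<Rightarrow> (nat \<Rightarrow> real^'m) \<Rightarrow> (nat \<Rightarrow> real) \<Rightarrow> real \<Rightarrow> real \<Rightarrow> real^'m \<Rightarrow> real^'m \<Rightarrow> real^'m" where
  "smoothed_hessian N x y l \<alpha> w p =
     l *\<^sub>R p + (1 / (real N * \<alpha>)) *\<^sub>R
       (\<Sum>i=1..N. (psi_deriv2 ((1 - y i * (w \<bullet> x i)) / \<alpha>) * (y i)\<^sup>2 * (p \<bullet> x i)) *\<^sub>R x i)"

lemma inner_smoothed_gradient:
  "p \<bullet> smoothed_gradient N x y l \<alpha> w =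
     l * (p \<bullet> w) - 1 / real N *
       (\<Sum>i=1..N. psi_deriv ((1 - y i * (w \<bullet> x i)) / \<alpha>) * y i * (p \<bullet> x i))"
  by (simp add: smoothed_gradient_def inner_diff_right inner_sum_right)

lemma inner_smoothed_hessian:
  "p \<bullet> smoothed_hessian N x y l \<alpha> w q =
     l * (p \<bullet> q) + 1 / (real N * \<alpha>) *
       (\<Sum>i=1..N. psi_deriv2 ((1 - y i * (w \<bullet> x i)) / \<alpha>) * (y i)\<^sup>2 * (q \<bullet> x i) * (p \<bullet> x i))"
  by (simp add: smoothed_hessian_def inner_add_right inner_sum_right)

lemma smoothed_hessian_symmetric:
  "p \<bullet> smoothed_hessian N x y l \<alpha> w q = q \<bullet> smoothed_hessian N x y l \<alpha> w p"
  by (simp add: inner_smoothed_hessian inner_commute mult.commute mult.left_commute)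

lemma GDERIV_smoothed_objective:
  assumes \<alpha>: "0 < \<alpha>"
  shows "GDERIV (smoothed_objective N x y l \<alpha>) w :> smoothed_gradient N x y l \<alpha> w"
proof -
  let ?z = "\<lambda>i w. (1 - y i * (w \<bullet> x i)) / \<alpha>"
  have arg: "(?z i has_derivative (\<lambda>h. - (y i * (h \<bullet> x i)) / \<alpha>)) (at w)" for i
    using \<alpha> by (auto intro!: derivative_eq_intros)
  have "((\<lambda>w. \<alpha> * psi (?z i w)) has_derivative
      (\<lambda>h. - (psi_deriv (?z i w) * y i * (h \<bullet> x i)))) (at w)" for i
    by (rule has_derivative_eq_rhs[OF has_derivative_mult_right[OF DERIV_compose_FDERIV[OF DERIV_psi arg]]])
      (use \<alpha> in \<open>simp add: fun_eq_iff\<close>)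
  then have "((\<lambda>w. \<Sum>i=1..N. \<alpha> * psi (?z i w)) has_derivative
      (\<lambda>h. \<Sum>i=1..N. - (psi_deriv (?z i w) * y i * (h \<bullet> x i)))) (at w)"
    by (rule has_derivative_sum)
  from has_derivative_mult_right[OF this, of "1 / real N"]
  have "((\<lambda>w. 1 / real N * (\<Sum>i=1..N. \<alpha> * psi (?z i w))) has_derivative
      (\<lambda>h. 1 / real N * (\<Sum>i=1..N. - (psi_deriv (?z i w) * y i * (h \<bullet> x i))))) (at w)" .
  moreover have "((\<lambda>w. 1/2 * l * (norm w)\<^sup>2) has_derivative (\<lambda>h. l * (h \<bullet> w))) (at w)"
    unfolding power2_norm_eq_inner
    by (auto intro!: derivative_eq_intros simp: inner_commute)
  ultimately have "(smoothed_objective N x y l \<alpha> has_derivative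
      (\<lambda>h. l * (h \<bullet> w) + 1 / real N * (\<Sum>i=1..N. - (psi_deriv (?z i w) * y i * (h \<bullet> x i))))) (at w)"
    unfolding smoothed_objective_def[abs_def] by (intro has_derivative_add)
  then show ?thesis
    unfolding gderiv_def inner_smoothed_gradient by (simp add: sum_negf)
qed

lemma smoothed_gradient_has_derivative:
  assumes \<alpha>: "0 < \<alpha>"
  shows "(smoothed_gradient N x y l \<alpha> has_derivative smoothed_hessian N x y l \<alpha> w) (at w)"
proof -
  let ?z = "\<lambda>i w. (1 - y i * (w \<bullet> x i)) / \<alpha>"
  have arg: "(?z i has_derivative (\<lambda>h. - (y i * (h \<bullet> x i)) / \<alpha>)) (at w)" for i
    using \<alpha> by (auto intro!: derivative_eq_intros)
  have "((\<lambda>w. (psi_deriv (?z i w) * y i) *\<^sub>R x i) has_derivative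
      (\<lambda>h. (- (y i * (h \<bullet> x i)) / \<alpha> * psi_deriv2 (?z i w) * y i) *\<^sub>R x i)) (at w)" for i
    by (intro has_derivative_scaleR_left has_derivative_mult_left
        DERIV_compose_FDERIV[OF DERIV_psi_deriv arg])
  then have "((\<lambda>w. \<Sum>i=1..N. (psi_deriv (?z i w) * y i) *\<^sub>R x i) has_derivative
      (\<lambda>h. \<Sum>i=1..N. (- (y i * (h \<bullet> x i)) / \<alpha> * psi_deriv2 (?z i w) * y i) *\<^sub>R x i)) (at w)"
    by (rule has_derivative_sum)
  then have "(smoothed_gradient N x y l \<alpha> has_derivative
      (\<lambda>h. l *\<^sub>R h - (1 / real N) *\<^sub>R
        (\<Sum>i=1..N. (- (y i * (h \<bullet> x i)) / \<alpha> * psi_deriv2 (?z i w) * y i) *\<^sub>R x i))) (at w)"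
    unfolding smoothed_gradient_def[abs_def]
    by (intro has_derivative_diff has_derivative_scaleR_right has_derivative_ident)
  moreover have "(\<Sum>i=1..N. (- (y i * (h \<bullet> x i)) / \<alpha> * psi_deriv2 (?z i w) * y i) *\<^sub>R x i) =
      - ((1 / \<alpha>) *\<^sub>R (\<Sum>i=1..N. (psi_deriv2 (?z i w) * (y i)\<^sup>2 * (h \<bullet> x i)) *\<^sub>R x i))" for h
    unfolding scaleR_sum_right sum_negf[symmetric] scaleR_minus_left[symmetric] scaleR_scaleR
    by (intro sum.cong refl arg_cong2[where f = scaleR]) (simp add: power2_eq_square)
  ultimately show ?thesis
    by (simp add: smoothed_hessian_def[abs_def])
qed

lemma smoothed_objective_shift:
  "smoothed_objective N x y l \<alpha> (w + p) =
    1/2 * l * (norm w)\<^sup>2 + l * (p \<bullet> w) + 1/2 * l * (norm p)\<^sup>2 + 1 / real N *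
      (\<Sum>i=1..N. \<alpha> * psi ((1 - y i * (w \<bullet> x i)) / \<alpha> + - (y i * (p \<bullet> x i) / \<alpha>)))"
proof -
  have "(1 - y i * ((w + p) \<bullet> x i)) / \<alpha> = (1 - y i * (w \<bullet> x i)) / \<alpha> + - (y i * (p \<bullet> x i) / \<alpha>)" for i
    by (simp add: inner_add_left diff_divide_distrib add_divide_distrib distrib_left)
  moreover have "(norm (w + p))\<^sup>2 = (norm w)\<^sup>2 + 2 * (p \<bullet> w) + (norm p)\<^sup>2"
    by (simp add: power2_norm_eq_inner inner_add_left inner_add_right inner_commute)
  ultimately show ?thesis
    unfolding smoothed_objective_def by (simp only:) (simp add: distrib_left)
qed

lemma smoothed_objective_above_tangent:
  assumes \<alpha>: "0 < \<alpha>" and l: "0 \<le> l"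
  shows "smoothed_objective N x y l \<alpha> w + p \<bullet> smoothed_gradient N x y l \<alpha> w
    \<le> smoothed_objective N x y l \<alpha> (w + p)"
proof -
  let ?z = "\<lambda>i. (1 - y i * (w \<bullet> x i)) / \<alpha>"
  let ?t = "\<lambda>i. y i * (p \<bullet> x i)"
  have summand: "\<alpha> * psi (?z i) - psi_deriv (?z i) * y i * (p \<bullet> x i) \<le> \<alpha> * psi (?z i + - (?t i / \<alpha>))" for i
    using mult_left_mono[OF psi_above_tangent[of "?z i" "- (?t i / \<alpha>)"], of \<alpha>] \<alpha>
    by (simp add: algebra_simps)
  define S S' T where "S = (\<Sum>i=1..N. \<alpha> * psi (?z i))"
    and "S' = (\<Sum>i=1..N. \<alpha> * psi (?z i + - (?t i / \<alpha>)))"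
    and "T = (\<Sum>i=1..N. psi_deriv (?z i) * y i * (p \<bullet> x i))"
  have "S - T \<le> S'"
    unfolding S_def S'_def T_def sum_subtractf[symmetric] by (intro sum_mono summand)
  then have "1 / real N * (S - T) \<le> 1 / real N * S'"
    by (rule mult_left_mono) simp
  moreover have "0 \<le> 1/2 * l * (norm p)\<^sup>2"
    using l by simp
  ultimately show ?thesis
    unfolding smoothed_objective_shift inner_smoothed_gradient
    unfolding smoothed_objective_def right_diff_distrib
      S_def[symmetric] S'_def[symmetric] T_def[symmetric] by linarith
qed

lemma square_inner_le: "((p::'a::real_inner) \<bullet> q)\<^sup>2 \<le> (norm p)\<^sup>2 * (norm q)\<^sup>2"
  using Cauchy_Schwarz_ineq[of p q] by (simp add: power2_norm_eq_inner)

text \<open>The bound \<open>1/2\<close> of \<open>psi_deriv2\<close> limits the curvature everywhere to a multiple of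
  \<open>1 / \<alpha>\<close>.  The constant is expressed through an upper bound \<open>\<alpha>0\<close> of the smoothing
  parameters in use.\<close>

definition curvature_bound :: "nat \<Rightarrow> (nat \<Rightarrow> real^'m) \<Rightarrow> real \<Rightarrow> real \<Rightarrow> real" where
  "curvature_bound N x l \<alpha>0 = l * \<alpha>0 + 1 / real N * (\<Sum>i=1..N. 1/2 * (norm (x i))\<^sup>2)"

lemma curvature_bound_scaled:
  assumes "0 < \<alpha>" "\<alpha> \<le> \<alpha>0" "0 \<le> l"
  shows "l * (norm p)\<^sup>2 + 1 / (real N * \<alpha>) * (\<Sum>i=1..N. 1/2 * (norm (x i))\<^sup>2 * (norm p)\<^sup>2)
    \<le> curvature_bound N x l \<alpha>0 / \<alpha> * (norm p)\<^sup>2"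
proof -
  have "l \<le> l * \<alpha>0 / \<alpha>"
    using assms by (simp add: pos_le_divide_eq mult_left_mono)
  then have "l * (norm p)\<^sup>2 \<le> l * \<alpha>0 / \<alpha> * (norm p)\<^sup>2"
    by (rule mult_right_mono) simp
  then show ?thesis
    unfolding curvature_bound_def sum_distrib_right[symmetric]
    by (simp add: add_divide_distrib distrib_right mult.assoc)
qed

lemma smoothed_objective_below_parabola:
  assumes \<alpha>: "0 < \<alpha>" "\<alpha> \<le> \<alpha>0" and l: "0 \<le> l"
    and labels: "\<And>i. i \<in> {1..N} \<Longrightarrow> y i \<in> {-1, 1}"
  shows "smoothed_objective N x y l \<alpha> (w + p)
    \<le> smoothed_objective N x y l \<alpha> w + p \<bullet> smoothed_gradient N x y l \<alpha> w
      + curvature_bound N x l \<alpha>0 / \<alpha> / 2 * (norm p)\<^sup>2"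
proof -
  let ?z = "\<lambda>i. (1 - y i * (w \<bullet> x i)) / \<alpha>"
  let ?t = "\<lambda>i. y i * (p \<bullet> x i)"
  let ?q = "\<lambda>i. 1/2 * (norm (x i))\<^sup>2 * (norm p)\<^sup>2"
  have summand: "\<alpha> * psi (?z i + - (?t i / \<alpha>))
      \<le> \<alpha> * psi (?z i) - psi_deriv (?z i) * y i * (p \<bullet> x i) + ?q i / (2 * \<alpha>)"
    if i: "i \<in> {1..N}" for i
  proof -
    have "(?t i)\<^sup>2 \<le> (norm (x i))\<^sup>2 * (norm p)\<^sup>2"
      using labels[OF i] square_inner_le[of p "x i"] by (auto simp: mult.commute)
    then have "(?t i)\<^sup>2 / (4 * \<alpha>) \<le> ?q i / (2 * \<alpha>)"
      using \<alpha>(1) by (simp add: divide_simps)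
    moreover have "\<alpha> * ((- (s / \<alpha>))\<^sup>2 / 4) = s\<^sup>2 / (4 * \<alpha>)" for s
      using \<alpha>(1) by (simp add: power2_eq_square)
    ultimately have "\<alpha> * ((- (?t i / \<alpha>))\<^sup>2 / 4) \<le> ?q i / (2 * \<alpha>)"
      by metis
    moreover have "\<alpha> * psi (?z i + - (?t i / \<alpha>)) \<le> \<alpha> * psi (?z i)
        - psi_deriv (?z i) * y i * (p \<bullet> x i) + \<alpha> * ((- (?t i / \<alpha>))\<^sup>2 / 4)"
      using mult_left_mono[OF psi_below_parabola[of "?z i" "- (?t i / \<alpha>)"], of \<alpha>] \<alpha>(1)
      by (simp add: algebra_simps)
    ultimately show ?thesis
      by linarith
  qed
  define S S' T Q where "S = (\<Sum>i=1..N. \<alpha> * psi (?z i))"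
    and "S' = (\<Sum>i=1..N. \<alpha> * psi (?z i + - (?t i / \<alpha>)))"
    and "T = (\<Sum>i=1..N. psi_deriv (?z i) * y i * (p \<bullet> x i))"
    and "Q = (\<Sum>i=1..N. ?q i)"
  have "S' \<le> S - T + Q / (2 * \<alpha>)"
    unfolding S_def S'_def T_def Q_def sum_divide_distrib sum_subtractf[symmetric] sum.distrib[symmetric]
    by (intro sum_mono summand)
  then have "1 / real N * S' \<le> 1 / real N * (S - T + Q / (2 * \<alpha>))"
    by (rule mult_left_mono) simp
  moreover have "1 / real N * (Q / (2 * \<alpha>)) \<le> k / 2 - 1/2 * l * (norm p)\<^sup>2"
    if "k = curvature_bound N x l \<alpha>0 / \<alpha> * (norm p)\<^sup>2" for k
  proof -
    define q where "q = 1 / (real N * \<alpha>) * Q"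
    have "l * (norm p)\<^sup>2 + q \<le> k"
      using curvature_bound_scaled[OF \<alpha> l, of p N x] by (simp add: that q_def Q_def)
    moreover have "1 / real N * (Q / (2 * \<alpha>)) = q / 2"
      by (simp add: q_def)
    ultimately show ?thesis
      by (simp add: field_simps)
  qed
  ultimately show ?thesis
    unfolding smoothed_objective_shift inner_smoothed_gradient
    unfolding smoothed_objective_def right_diff_distrib distrib_left
      S_def[symmetric] S'_def[symmetric] T_def[symmetric] by fastforce
qed

lemma smoothed_hessian_le:
  assumes \<alpha>: "0 < \<alpha>" "\<alpha> \<le> \<alpha>0" and l: "0 \<le> l"
    and labels: "\<And>i. i \<in> {1..N} \<Longrightarrow> y i \<in> {-1, 1}"
  shows "p \<bullet> smoothed_hessian N x y l \<alpha> w p \<le> curvature_bound N x l \<alpha>0 / \<alpha> * (norm p)\<^sup>2"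
proof -
  let ?z = "\<lambda>i. (1 - y i * (w \<bullet> x i)) / \<alpha>"
  have "psi_deriv2 (?z i) * (y i)\<^sup>2 * (p \<bullet> x i) * (p \<bullet> x i) \<le> 1/2 * (norm (x i))\<^sup>2 * (norm p)\<^sup>2"
    if "i \<in> {1..N}" for i
  proof -
    have "psi_deriv2 (?z i) * (p \<bullet> x i)\<^sup>2 \<le> 1/2 * ((norm p)\<^sup>2 * (norm (x i))\<^sup>2)"
      using psi_deriv2_le square_inner_le by (intro mult_mono) auto
    moreover have "(y i)\<^sup>2 = 1"
      using labels[OF that] by auto
    ultimately show ?thesis
      by (simp add: power2_eq_square mult.commute mult.left_commute)
  qed
  then have "1 / (real N * \<alpha>) * (\<Sum>i=1..N. psi_deriv2 (?z i) * (y i)\<^sup>2 * (p \<bullet> x i) * (p \<bullet> x i))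
      \<le> 1 / (real N * \<alpha>) * (\<Sum>i=1..N. 1/2 * (norm (x i))\<^sup>2 * (norm p)\<^sup>2)"
    using \<alpha> by (intro mult_left_mono sum_mono) auto
  then show ?thesis
    using curvature_bound_scaled[OF \<alpha> l, of p N x]
    unfolding inner_smoothed_hessian power2_norm_eq_inner[of p, symmetric] by linarith
qed

lemma norm_smoothed_gradient_le:
  assumes l: "0 \<le> l" and labels: "\<And>i. i \<in> {1..N} \<Longrightarrow> y i \<in> {-1, 1}"
  shows "norm (smoothed_gradient N x y l \<alpha> w) \<le> l * norm w + 1 / real N * (\<Sum>i=1..N. norm (x i))"
proof -
  have "norm ((psi_deriv u * y i) *\<^sub>R x i) \<le> norm (x i)" if "i \<in> {1..N}" for i u
    using abs_psi_deriv_le[of u] labels[OF that]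
    by (auto simp: abs_mult intro: mult_left_le_one_le)
  then have "norm (\<Sum>i=1..N. (psi_deriv ((1 - y i * (w \<bullet> x i)) / \<alpha>) * y i) *\<^sub>R x i)
      \<le> (\<Sum>i=1..N. norm (x i))"
    by (intro sum_norm_le)
  then have "1 / real N * norm (\<Sum>i=1..N. (psi_deriv ((1 - y i * (w \<bullet> x i)) / \<alpha>) * y i) *\<^sub>R x i)
      \<le> 1 / real N * (\<Sum>i=1..N. norm (x i))"
    by (rule mult_left_mono) simp
  then show ?thesis
    unfolding smoothed_gradient_def
    by (intro norm_triangle_le_diff) (use l in simp)
qed

lemma hinge_le_smoothed_objective:
  assumes \<alpha>: "0 < \<alpha>"
  shows "hinge_objective N x y l w \<le> smoothed_objective N x y l \<alpha> w"
proof -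
  have "max 0 u \<le> \<alpha> * psi (u / \<alpha>)" for u
    using mult_left_mono[OF hinge_le_psi[of "u / \<alpha>"], of \<alpha>] \<alpha> by (simp add: max_mult_distrib_left)
  then show ?thesis
    unfolding hinge_objective_def smoothed_objective_def
    by (intro add_left_mono mult_left_mono sum_mono) auto
qed

lemma smoothed_objective_le_hinge:
  assumes \<alpha>: "0 < \<alpha>"
  shows "smoothed_objective N x y l \<alpha> w \<le> hinge_objective N x y l w + \<alpha> / 2"
proof -
  have "\<alpha> * psi (u / \<alpha>) \<le> max 0 u + \<alpha> / 2" for u
    using mult_left_mono[OF psi_le_hinge[of "u / \<alpha>"], of \<alpha>] \<alpha>
    by (simp add: max_mult_distrib_left distrib_left)
  then have "1 / real N * (\<Sum>i=1..N. \<alpha> * psi ((1 - y i * (w \<bullet> x i)) / \<alpha>))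
      \<le> 1 / real N * (\<Sum>i=1..N. max 0 (1 - y i * (w \<bullet> x i)) + \<alpha> / 2)"
    by (intro mult_left_mono sum_mono) auto
  also have "\<dots> \<le> 1 / real N * (\<Sum>i=1..N. max 0 (1 - y i * (w \<bullet> x i))) + \<alpha> / 2"
    using \<alpha> by (simp add: sum.distrib add_divide_distrib)
  finally show ?thesis
    unfolding hinge_objective_def smoothed_objective_def by linarith
qed


section \<open>Nondegenerate vertices\<close>

locale nondegenerate_vertex =
  fixes N :: nat and x :: "nat \<Rightarrow> real^'m" and y :: "nat \<Rightarrow> real" and l :: real
    and wstar :: "real^'m" and I :: "nat set" and \<theta> :: "nat \<Rightarrow> real"
  assumes labels: "\<And>i. i \<in> {1..N} \<Longrightarrow> y i \<in> {-1, 1}"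
    and l_nonneg: "0 \<le> l"
    and I_eq: "I = {i \<in> {1..N}. 1 = y i * (x i \<bullet> wstar)}"
    and card_I: "card I = CARD('m)"
    and inj_x: "inj_on x I" and independent_x: "independent (x ` I)"
    and stationary:
      "(\<Sum>i\<in>I. (\<theta> i * y i) *\<^sub>R x i)
         + (\<Sum>j\<in>{j \<in> {1..N}. j \<notin> I \<and> 1 > y j * (x j \<bullet> wstar)}. y j *\<^sub>R x j)
         - (real N * l) *\<^sub>R wstar = 0"
    and \<theta>_bounds: "\<And>i. i \<in> I \<Longrightarrow> 0 < \<theta> i \<and> \<theta> i < 1"
begin

lemma I_subset: "I \<subseteq> {1..N}"
  by (auto simp: I_eq)

lemma finite_I: "finite I"
  using I_subset finite_subset by blast

lemma N_pos: "0 < real N"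
proof -
  have "I \<noteq> {}"
    using card_I by auto
  then show ?thesis
    using I_subset by auto
qed

lemma span_x: "span (x ` I) = UNIV"
proof -
  have "card (x ` I) = DIM(real^'m)"
    using card_image[OF inj_x] card_I by simp
  then show ?thesis
    using independent_x dim_eq_card_independent dim_eq_full by metis
qed

text \<open>The sum is continuous in \<open>a\<close> and, as the \<open>x i\<close> span the space, vanishes only at
  \<open>0\<close>; its minimum on the unit sphere is therefore positive.\<close>

lemma sum_abs_inner_coercive: "\<exists>\<kappa>>0. \<forall>a. \<kappa> * norm a \<le> (\<Sum>i\<in>I. \<bar>a \<bullet> x i\<bar>)"
proof -
  let ?h = "\<lambda>a. \<Sum>i\<in>I. \<bar>a \<bullet> x i\<bar>"
  have "continuous_on (sphere 0 1) ?h"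
    by (intro continuous_intros)
  then obtain a0 where a0: "norm a0 = 1" "\<And>a. norm a = 1 \<Longrightarrow> ?h a0 \<le> ?h a"
    using continuous_attains_inf[of "sphere 0 1" ?h] by auto
  have "?h a0 \<noteq> 0"
  proof
    assume "?h a0 = 0"
    then have "\<forall>v \<in> x ` I. orthogonal a0 v"
      using finite_I by (simp add: sum_nonneg_eq_0_iff orthogonal_def)
    then have "orthogonal a0 a0"
      using span_x orthogonal_to_span by (metis UNIV_I)
    then show False
      using a0(1) by (simp add: orthogonal_self)
  qed
  then have pos: "0 < ?h a0"
    by (metis abs_ge_zero less_eq_real_def sum_nonneg)
  have "?h a0 * norm a \<le> ?h a" for a
  proof (cases "a = 0")
    case False
    then have "?h a0 * norm a \<le> ?h (a /\<^sub>R norm a) * norm a"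
      by (intro mult_right_mono a0(2)) auto
    also have "\<dots> = ?h a"
      using False by (simp add: abs_mult sum_distrib_left[symmetric])
    finally show ?thesis .
  qed simp
  with pos show ?thesis
    by blast
qed

text \<open>By the stationarity equation, assigning the slope \<open>\<theta> i\<close> to the hinge of each example in
  \<open>I\<close>, which sits at its kink, yields the subgradient \<open>0\<close> at \<open>wstar\<close>.  Each of these hinges
  exceeds its line of slope \<open>\<theta> i\<close> by at least \<open>min (\<theta> i) (1 - \<theta> i)\<close> times the distance
  from the kink.  The excesses grow in every direction because the \<open>x i\<close> span the space.\<close>

lemma sharp_minimum:
  "\<exists>c>0. \<forall>w. hinge_objective N x y l wstar + c * norm (w - wstar) \<le> hinge_objective N x y l w"
proof -
  obtain \<kappa> where \<kappa>: "\<kappa> > 0" "\<And>a. \<kappa> * norm a \<le> (\<Sum>i\<in>I. \<bar>a \<bullet> x i\<bar>)"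
    using sum_abs_inner_coercive by blast
  have "I \<noteq> {}"
    using card_I by auto
  define \<rho> where "\<rho> = Min ((\<lambda>i. min (\<theta> i) (1 - \<theta> i)) ` I)"
  have "\<rho> \<le> min (\<theta> i) (1 - \<theta> i)" if "i \<in> I" for i
    unfolding \<rho>_def using finite_I that by (intro Min_le) auto
  moreover have "\<rho> > 0"
    unfolding \<rho>_def using finite_I \<open>I \<noteq> {}\<close> \<theta>_bounds by simp
  ultimately have \<rho>: "\<rho> > 0" "\<And>i. i \<in> I \<Longrightarrow> \<rho> \<le> \<theta> i \<and> \<rho> \<le> 1 - \<theta> i"
    by auto
  define J where "J = {j \<in> {1..N}. j \<notin> I \<and> 1 > y j * (x j \<bullet> wstar)}"
  have J: "J \<subseteq> {1..N}" "I \<inter> J = {}" "finite J"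
    by (auto simp: J_def)
  \<comment> \<open>A subgradient of \<open>max 0\<close> at \<open>1 - y i * (wstar \<bullet> x i)\<close>; only on \<open>I\<close> is there a choice.\<close>
  define slope where "slope i = (if i \<in> I then \<theta> i else if i \<in> J then 1 else 0)" for i
  have growth: "hinge_objective N x y l wstar + 1 / real N * (\<rho> * (\<kappa> * norm (w - wstar)))
      \<le> hinge_objective N x y l w" for w
  proof -
    define a where "a = w - wstar"
    have w: "w = wstar + a"
      by (simp add: a_def)
    have hinge_term: "max 0 (1 - y i * (wstar \<bullet> x i)) - slope i * y i * (a \<bullet> x i)
        + (if i \<in> I then \<rho> * \<bar>a \<bullet> x i\<bar> else 0) \<le> max 0 (1 - y i * (w \<bullet> x i))"
      if i: "i \<in> {1..N}" for i
    proof -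
      have split: "y i * (w \<bullet> x i) = y i * (wstar \<bullet> x i) + y i * (a \<bullet> x i)"
        by (simp add: w inner_add_left distrib_left)
      consider "i \<in> I" | "i \<in> J" | "i \<notin> I" "i \<notin> J"
        by blast
      then show ?thesis
      proof cases
        case 1
        then have kink: "y i * (wstar \<bullet> x i) = 1"
          by (simp add: I_eq inner_commute)
        define v where "v = - (y i * (a \<bullet> x i))"
        have absv: "\<bar>a \<bullet> x i\<bar> = \<bar>v\<bar>"
          using labels[OF i] by (auto simp: v_def)
        have "\<theta> i * v + \<rho> * \<bar>v\<bar> \<le> max 0 v"
        proof (cases "v \<ge> 0")
          case True
          then show ?thesis
            using mult_right_mono[of \<rho> "1 - \<theta> i" v] \<rho>(2)[OF 1] by (simp add: algebra_simps)
        next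
          case False
          then show ?thesis
            using mult_right_mono_neg[of \<rho> "\<theta> i" v] \<rho>(2)[OF 1] by simp
        qed
        then show ?thesis
          using 1 by (simp add: slope_def split kink absv v_def)
      next
        case 2
        then show ?thesis
          using J(2) by (auto simp: slope_def split J_def inner_commute)
      next
        case 3
        then have "y i * (wstar \<bullet> x i) \<ge> 1"
          using i by (auto simp: J_def inner_commute)
        with 3 show ?thesis
          by (simp add: slope_def)
      qed
    qed
    have slopes: "(\<Sum>i=1..N. slope i * y i * (a \<bullet> x i)) = real N * l * (a \<bullet> wstar)"
    proof -
      have "(\<Sum>i=1..N. slope i * y i * (a \<bullet> x i)) = (\<Sum>i\<in>I \<union> J. slope i * y i * (a \<bullet> x i))"
        using J(1) I_subset by (intro sum.mono_neutral_right) (auto simp: slope_def)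
      also have "\<dots> = (\<Sum>i\<in>I. slope i * y i * (a \<bullet> x i)) + (\<Sum>i\<in>J. slope i * y i * (a \<bullet> x i))"
        using finite_I J by (intro sum.union_disjoint)
      also have "\<dots> = a \<bullet> ((\<Sum>i\<in>I. (\<theta> i * y i) *\<^sub>R x i) + (\<Sum>j\<in>J. y j *\<^sub>R x j))"
        unfolding inner_add_right inner_sum_right
        using J(2) by (intro arg_cong2[where f = plus] sum.cong) (auto simp: slope_def)
      also have "(\<Sum>i\<in>I. (\<theta> i * y i) *\<^sub>R x i) + (\<Sum>j\<in>J. y j *\<^sub>R x j) = (real N * l) *\<^sub>R wstar"
        using stationary unfolding J_def by simp
      finally show ?thesis
        by simp
    qed
    have "(\<Sum>i=1..N. max 0 (1 - y i * (wstar \<bullet> x i))) - real N * l * (a \<bullet> wstar) + \<rho> * (\<kappa> * norm a)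
        \<le> (\<Sum>i=1..N. max 0 (1 - y i * (wstar \<bullet> x i))) - (\<Sum>i=1..N. slope i * y i * (a \<bullet> x i))
          + (\<Sum>i=1..N. if i \<in> I then \<rho> * \<bar>a \<bullet> x i\<bar> else 0)"
    proof -
      have "(\<Sum>i=1..N. if i \<in> I then \<rho> * \<bar>a \<bullet> x i\<bar> else 0) = \<rho> * (\<Sum>i\<in>I. \<bar>a \<bullet> x i\<bar>)"
        using I_subset by (simp add: sum.inter_restrict[symmetric] Int_absorb1 sum_distrib_left)
      then show ?thesis
        using mult_left_mono[OF \<kappa>(2)[of a], of \<rho>] \<rho>(1) unfolding slopes by simp
    qed
    also have "\<dots> \<le> (\<Sum>i=1..N. max 0 (1 - y i * (w \<bullet> x i)))"
      unfolding sum_subtractf[symmetric] sum.distrib[symmetric] by (intro sum_mono hinge_term)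
    finally have "1 / real N * ((\<Sum>i=1..N. max 0 (1 - y i * (wstar \<bullet> x i)))
        - real N * l * (a \<bullet> wstar) + \<rho> * (\<kappa> * norm a))
        \<le> 1 / real N * (\<Sum>i=1..N. max 0 (1 - y i * (w \<bullet> x i)))"
      by (rule mult_left_mono) simp
    moreover have "1 / real N * (real N * l * (a \<bullet> wstar)) = l * (a \<bullet> wstar)"
      using N_pos by simp
    moreover have "1/2 * l * (norm w)\<^sup>2 \<ge> 1/2 * l * (norm wstar)\<^sup>2 + l * (a \<bullet> wstar)"
    proof -
      have "(norm w)\<^sup>2 = (norm wstar)\<^sup>2 + 2 * (a \<bullet> wstar) + (norm a)\<^sup>2"
        by (simp add: w power2_norm_eq_inner inner_add_left inner_add_right inner_commute)
      moreover have "0 \<le> l * (norm a)\<^sup>2"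
        using l_nonneg by simp
      ultimately show ?thesis
        by (simp add: algebra_simps)
    qed
    ultimately show ?thesis
      unfolding hinge_objective_def a_def[symmetric] distrib_left right_diff_distrib by linarith
  qed
  show ?thesis
    by (rule exI[of _ "1 / real N * (\<rho> * \<kappa>)"]) (use growth \<rho>(1) \<kappa>(1) N_pos in \<open>simp add: mult.assoc\<close>)
qed

text \<open>At distance at most \<open>R * \<alpha>\<close> from the vertex the arguments of \<open>psi\<close> belonging to \<open>I\<close>
  stay bounded, hence so do their second derivatives from below.\<close>

lemma smoothed_hessian_ge:
  "\<exists>\<mu>>0. \<forall>\<alpha> w p. 0 < \<alpha> \<longrightarrow> norm (w - wstar) \<le> R * \<alpha> \<longrightarrow>
     \<mu> / \<alpha> * (norm p)\<^sup>2 \<le> p \<bullet> smoothed_hessian N x y l \<alpha> w p"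
proof -
  obtain \<kappa> where \<kappa>: "\<kappa> > 0" "\<And>a. \<kappa> * norm a \<le> (\<Sum>i\<in>I. \<bar>a \<bullet> x i\<bar>)"
    using sum_abs_inner_coercive by blast
  define X where "X = (\<Sum>i=1..N. norm (x i))"
  define m where "m = real (card I)"
  have m: "m > 0"
    using card_I by (simp add: m_def)
  define \<mu> where "\<mu> = psi_deriv2 (R * X) * (\<kappa>\<^sup>2 / m) / real N"
  have "\<mu> / \<alpha> * (norm p)\<^sup>2 \<le> p \<bullet> smoothed_hessian N x y l \<alpha> w p"
    if \<alpha>: "0 < \<alpha>" and near: "norm (w - wstar) \<le> R * \<alpha>" for \<alpha> w p
  proof -
    let ?z = "\<lambda>i. (1 - y i * (w \<bullet> x i)) / \<alpha>"
    have lower: "psi_deriv2 (R * X) * (p \<bullet> x i)\<^sup>2 \<le> psi_deriv2 (?z i) * (y i)\<^sup>2 * (p \<bullet> x i) * (p \<bullet> x i)"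
      if i: "i \<in> I" for i
    proof -
      have iN: "i \<in> {1..N}"
        using i I_subset by blast
      have "y i * (wstar \<bullet> x i) = 1"
        using i by (simp add: I_eq inner_commute)
      then have "1 - y i * (w \<bullet> x i) = - (y i * ((w - wstar) \<bullet> x i))"
        by (simp add: inner_diff_left right_diff_distrib)
      then have "\<bar>1 - y i * (w \<bullet> x i)\<bar> = \<bar>(w - wstar) \<bullet> x i\<bar>"
        using labels[OF iN] by auto
      also have "\<dots> \<le> norm (w - wstar) * norm (x i)"
        by (rule Cauchy_Schwarz_ineq2)
      also have "\<dots> \<le> (R * \<alpha>) * X"
      proof (rule mult_mono[OF near])
        show "norm (x i) \<le> X"
          unfolding X_def using iN by (intro member_le_sum) auto
        show "0 \<le> R * \<alpha>"
          using near norm_ge_zero order_trans by blast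
      qed simp
      finally have "\<bar>?z i\<bar> \<le> R * X"
        using \<alpha> by (simp add: abs_divide pos_divide_le_eq mult.commute mult.left_commute)
      then have "psi_deriv2 (R * X) * (p \<bullet> x i)\<^sup>2 \<le> psi_deriv2 (?z i) * (p \<bullet> x i)\<^sup>2"
        by (intro mult_right_mono psi_deriv2_antimono) auto
      moreover have "(y i)\<^sup>2 = 1"
        using labels[OF iN] by auto
      ultimately show ?thesis
        by (simp add: power2_eq_square mult.assoc)
    qed
    have "(\<kappa> * norm p)\<^sup>2 \<le> (\<Sum>i\<in>I. \<bar>p \<bullet> x i\<bar>)\<^sup>2"
      using \<kappa> by (intro power_mono) auto
    also have "\<dots> \<le> (\<Sum>i\<in>I. (p \<bullet> x i)\<^sup>2) * m"
      using sum_squared_le_sum_of_squares[of "\<lambda>i. \<bar>p \<bullet> x i\<bar>" I] by (simp add: m_def)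
    finally have "\<kappa>\<^sup>2 / m * (norm p)\<^sup>2 \<le> (\<Sum>i\<in>I. (p \<bullet> x i)\<^sup>2)"
      using m by (simp add: pos_divide_le_eq power_mult_distrib)
    then have "psi_deriv2 (R * X) * (\<kappa>\<^sup>2 / m * (norm p)\<^sup>2) \<le> psi_deriv2 (R * X) * (\<Sum>i\<in>I. (p \<bullet> x i)\<^sup>2)"
      using psi_deriv2_pos[of "R * X"] by (intro mult_left_mono) auto
    also have "\<dots> \<le> (\<Sum>i\<in>I. psi_deriv2 (?z i) * (y i)\<^sup>2 * (p \<bullet> x i) * (p \<bullet> x i))"
      unfolding sum_distrib_left by (intro sum_mono lower)
    also have "\<dots> \<le> (\<Sum>i=1..N. psi_deriv2 (?z i) * (y i)\<^sup>2 * (p \<bullet> x i) * (p \<bullet> x i))"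
    proof (intro sum_mono2 I_subset)
      show "0 \<le> psi_deriv2 (?z i) * (y i)\<^sup>2 * (p \<bullet> x i) * (p \<bullet> x i)" for i
        using psi_deriv2_pos[of "?z i"] by (simp add: mult.assoc)
    qed simp
    finally have "1 / (real N * \<alpha>) * (psi_deriv2 (R * X) * (\<kappa>\<^sup>2 / m * (norm p)\<^sup>2))
        \<le> 1 / (real N * \<alpha>) * (\<Sum>i=1..N. psi_deriv2 (?z i) * (y i)\<^sup>2 * (p \<bullet> x i) * (p \<bullet> x i))"
      using \<alpha> by (intro mult_left_mono) auto
    moreover have "0 \<le> l * (p \<bullet> p)"
      using l_nonneg by simp
    moreover have "\<mu> / \<alpha> * (norm p)\<^sup>2
        = 1 / (real N * \<alpha>) * (psi_deriv2 (R * X) * (\<kappa>\<^sup>2 / m * (norm p)\<^sup>2))"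
      by (simp add: \<mu>_def mult_ac)
    ultimately show ?thesis
      unfolding inner_smoothed_hessian by linarith
  qed
  moreover have "\<mu> > 0"
    using psi_deriv2_pos \<kappa>(1) m N_pos by (simp add: \<mu>_def)
  ultimately show ?thesis
    by blast
qed

lemma smoothed_hessian_pos:
  assumes \<alpha>: "0 < \<alpha>" and p: "p \<noteq> 0"
  shows "0 < p \<bullet> smoothed_hessian N x y l \<alpha> w p"
proof -
  obtain \<mu> where "\<mu> > 0" "\<mu> / \<alpha> * (norm p)\<^sup>2 \<le> p \<bullet> smoothed_hessian N x y l \<alpha> w p"
    using smoothed_hessian_ge[of "norm (w - wstar) / \<alpha>"] \<alpha> by fastforce
  moreover have "0 < \<mu> / \<alpha> * (norm p)\<^sup>2"
    using \<open>\<mu> > 0\<close> \<alpha> p by simp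
  ultimately show ?thesis
    by linarith
qed

lemma curvature_bound_pos:
  assumes "0 < \<alpha>0"
  shows "0 < curvature_bound N x l \<alpha>0"
proof -
  define p :: "real^'m" where "p = axis undefined 1"
  have p: "norm p = 1"
    by (simp add: p_def)
  then have "0 < p \<bullet> smoothed_hessian N x y l \<alpha>0 0 p"
    by (intro smoothed_hessian_pos assms) auto
  also have "\<dots> \<le> curvature_bound N x l \<alpha>0 / \<alpha>0 * (norm p)\<^sup>2"
    by (rule smoothed_hessian_le) (use assms l_nonneg labels in auto)
  finally show ?thesis
    using assms p by (simp add: zero_less_divide_iff)
qed

text \<open>By convexity and the sharp minimum, the slope at \<open>w\<close> in the direction \<open>a\<close> away from
  the vertex is at least \<open>c * norm a - \<alpha> / 2\<close>, hence more than \<open>c * norm a / 2\<close> once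
  \<open>norm a > \<alpha> / c\<close>.  By the Cauchy--Schwarz estimate the decrement then is at least
  \<open>c\<^sup>2 / (4 * K) * \<alpha>\<close>, where \<open>K / \<alpha>\<close> bounds the curvature.  This is where \<open>\<eta>\<close>
  must be small.\<close>

lemma stopping_criterion_near_vertex:
  assumes \<alpha>0: "0 < \<alpha>0"
  shows "\<exists>\<eta>0>0. \<exists>R. \<forall>\<eta> \<alpha> w. \<eta> < \<eta>0 \<longrightarrow> 0 < \<alpha> \<longrightarrow> \<alpha> \<le> \<alpha>0 \<longrightarrow>
    stopping_criterion (smoothed_objective N x y l) \<eta> (\<alpha>, w) \<longrightarrow> norm (w - wstar) \<le> R * \<alpha>"
proof -
  define K where "K = curvature_bound N x l \<alpha>0"
  have K: "K > 0"
    unfolding K_def by (rule curvature_bound_pos[OF \<alpha>0])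
  obtain c where c: "c > 0"
    "\<And>w. hinge_objective N x y l wstar + c * norm (w - wstar) \<le> hinge_objective N x y l w"
    using sharp_minimum by blast
  have "norm (w - wstar) \<le> 1 / c * \<alpha>"
    if \<eta>: "\<eta> < c\<^sup>2 / (4 * K)" and \<alpha>: "0 < \<alpha>" "\<alpha> \<le> \<alpha>0"
      and stop: "stopping_criterion (smoothed_objective N x y l) \<eta> (\<alpha>, w)" for \<eta> \<alpha> w
  proof (rule ccontr)
    let ?F = "smoothed_objective N x y l \<alpha>"
    let ?g = "smoothed_gradient N x y l \<alpha> w"
    define a where "a = w - wstar"
    define \<delta> where "\<delta> = \<bar>newton_direction ?F w \<bullet> gradient ?F w\<bar>"
    assume "\<not> ?thesis"
    then have far: "\<alpha> < c * norm a"
      using c(1) by (simp add: a_def field_simps)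
    have "w + - a = wstar"
      by (simp add: a_def)
    then have "?F w - a \<bullet> ?g \<le> ?F wstar"
      using smoothed_objective_above_tangent[OF \<alpha>(1) l_nonneg, of N x y w "- a"] by simp
    moreover have "?F wstar \<le> hinge_objective N x y l wstar + \<alpha> / 2"
      by (rule smoothed_objective_le_hinge[OF \<alpha>(1)])
    moreover have "hinge_objective N x y l w \<le> ?F w"
      by (rule hinge_le_smoothed_objective[OF \<alpha>(1)])
    ultimately have "c * norm a / 2 \<le> a \<bullet> ?g"
      using c(2)[of w] far unfolding a_def[symmetric] by linarith
    then have "(c * norm a / 2)\<^sup>2 \<le> (a \<bullet> ?g)\<^sup>2"
      using c(1) by (intro power_mono) auto
    also have "\<dots> \<le> \<delta> * (a \<bullet> smoothed_hessian N x y l \<alpha> w a)"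
      unfolding \<delta>_def
      by (rule slope_le_newton_decrement[OF GDERIV_smoothed_objective[OF \<alpha>(1)]
            smoothed_gradient_has_derivative[OF \<alpha>(1)] smoothed_hessian_pos[OF \<alpha>(1)]
            smoothed_hessian_symmetric])
    also have "\<dots> \<le> (\<eta> * \<alpha>) * (K / \<alpha> * (norm a)\<^sup>2)"
    proof (rule mult_mono)
      show "\<delta> \<le> \<eta> * \<alpha>"
        using stop by (simp add: stopping_criterion_def \<delta>_def)
      then show "0 \<le> \<eta> * \<alpha>"
        by (simp add: \<delta>_def)
      show "a \<bullet> smoothed_hessian N x y l \<alpha> w a \<le> K / \<alpha> * (norm a)\<^sup>2"
        unfolding K_def by (rule smoothed_hessian_le[OF \<alpha> l_nonneg labels])
      show "0 \<le> a \<bullet> smoothed_hessian N x y l \<alpha> w a"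
        using smoothed_hessian_pos[OF \<alpha>(1), of a w] by (cases "a = 0") auto
    qed
    also have "\<dots> = \<eta> * K * (norm a)\<^sup>2"
      using \<alpha>(1) by simp
    finally have "c\<^sup>2 / 4 * (norm a)\<^sup>2 \<le> \<eta> * K * (norm a)\<^sup>2"
      by (simp add: power_mult_distrib power_divide)
    moreover have "norm a > 0"
      using far \<alpha>(1) c(1) by (smt (verit) mult_nonneg_nonpos norm_ge_zero)
    ultimately have "c\<^sup>2 / 4 \<le> \<eta> * K"
      by simp
    moreover have "\<eta> * K < c\<^sup>2 / 4"
      using \<eta> K by (simp add: field_simps)
    ultimately show False
      by linarith
  qed
  moreover have "c\<^sup>2 / (4 * K) > 0"
    using c(1) K by simp
  ultimately show ?thesis
    by blast
qed

text \<open>A start at distance at most \<open>C * \<alpha>\<close> from the vertex has an objective value at most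
  a multiple of \<open>\<alpha>\<close> above the minimum.  By the sharp minimum its sublevel set lies within
  distance \<open>R * \<alpha>\<close> for some fixed \<open>R\<close>, so there the condition number of the Hessian is
  bounded and every Newton step made before the stopping criterion holds lowers the
  objective by at least a fixed multiple of \<open>\<alpha>\<close>.
  The factor \<open>\<alpha>\<close> cancels in the number of steps.\<close>

lemma stage_ends_uniformly:
  assumes \<alpha>0: "0 < \<alpha>0" and \<eta>: "0 < \<eta>" and c1: "0 < c1" "c1 < 1"
  shows "\<exists>n. \<forall>\<alpha> w. 0 < \<alpha> \<longrightarrow> \<alpha> \<le> \<alpha>0 \<longrightarrow> norm (w - wstar) \<le> C * \<alpha> \<longrightarrow>
    stage_ends_within (smoothed_objective N x y l) \<beta> c1 \<eta> \<alpha> w n"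
proof -
  let ?F = "smoothed_objective N x y l"
  let ?f = "hinge_objective N x y l"
  define K where "K = curvature_bound N x l \<alpha>0"
  have K: "K > 0"
    unfolding K_def by (rule curvature_bound_pos[OF \<alpha>0])
  obtain c where c: "c > 0" "\<And>w. ?f wstar + c * norm (w - wstar) \<le> ?f w"
    using sharp_minimum by blast
  define G where "G = l * norm wstar + 1 / real N * (\<Sum>i=1..N. norm (x i))"
  define D where "D = C * G + K / 2 * C\<^sup>2 + 1/2"
  obtain \<mu> where \<mu>: "\<mu> > 0" "\<And>\<alpha> w p. 0 < \<alpha> \<Longrightarrow> norm (w - wstar) \<le> D / c * \<alpha> \<Longrightarrow>
      \<mu> / \<alpha> * (norm p)\<^sup>2 \<le> p \<bullet> smoothed_hessian N x y l \<alpha> w p"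
    using smoothed_hessian_ge[of "D / c"] by blast
  define \<epsilon> where "\<epsilon> = c1 * min 1 (\<mu> * (1 - c1) / K) * \<eta>"
  have \<epsilon>: "\<epsilon> > 0"
    using c1 \<mu>(1) K \<eta> by (simp add: \<epsilon>_def)
  obtain n where n: "D < real n * \<epsilon>"
    using reals_Archimedean3[OF \<epsilon>] by blast
  have "stage_ends_within ?F \<beta> c1 \<eta> \<alpha> w n"
    if \<alpha>: "0 < \<alpha>" "\<alpha> \<le> \<alpha>0" and w: "norm (w - wstar) \<le> C * \<alpha>" for \<alpha> w
  proof (rule stage_ends_by_decrease[where \<epsilon> = "\<epsilon> * \<alpha>" and B = "?f wstar"])
    have start: "?F \<alpha> w \<le> ?f wstar + D * \<alpha>"
    proof -
      let ?g = "smoothed_gradient N x y l \<alpha> wstar"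
      have "?F \<alpha> w \<le> ?F \<alpha> wstar + (w - wstar) \<bullet> ?g + K / \<alpha> / 2 * (norm (w - wstar))\<^sup>2"
        using smoothed_objective_below_parabola[OF \<alpha> l_nonneg labels, where w = wstar and p = "w - wstar" and x = x]
        unfolding K_def by simp
      moreover have "(w - wstar) \<bullet> ?g \<le> C * \<alpha> * G"
      proof -
        have "(w - wstar) \<bullet> ?g \<le> norm (w - wstar) * norm ?g"
          by (rule norm_cauchy_schwarz)
        also have "\<dots> \<le> C * \<alpha> * G"
          unfolding G_def using w norm_smoothed_gradient_le[OF l_nonneg labels]
            order_trans[OF norm_ge_zero w]
          by (intro mult_mono) auto
        finally show ?thesis .
      qed
      moreover have "K / \<alpha> / 2 * (norm (w - wstar))\<^sup>2 \<le> K / \<alpha> / 2 * (C * \<alpha>)\<^sup>2"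
        using w K \<alpha> by (intro mult_left_mono power_mono) auto
      moreover have "K / \<alpha> / 2 * (C * \<alpha>)\<^sup>2 = K / 2 * C\<^sup>2 * \<alpha>"
        using \<alpha>(1) by (simp add: power2_eq_square)
      moreover have "?F \<alpha> wstar \<le> ?f wstar + \<alpha> / 2"
        by (rule smoothed_objective_le_hinge[OF \<alpha>(1)])
      moreover have "D * \<alpha> = C * \<alpha> * G + K / 2 * C\<^sup>2 * \<alpha> + \<alpha> / 2"
        by (simp add: D_def algebra_simps)
      ultimately show ?thesis
        by linarith
    qed
    show "?F \<alpha> (guarded_newton_step c1 (?F \<alpha>) v) \<le> ?F \<alpha> v - \<epsilon> * \<alpha>"
      if below: "?F \<alpha> v \<le> ?F \<alpha> w" and go: "\<not> stopping_criterion ?F \<eta> (\<alpha>, v)" for v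
    proof -
      have "c * norm (v - wstar) \<le> D * \<alpha>"
        using c(2)[of v] hinge_le_smoothed_objective[OF \<alpha>(1), of N x y l v] below start by linarith
      then have near: "norm (v - wstar) \<le> D / c * \<alpha>"
        using c(1) by (simp add: field_simps)
      have ratio: "\<mu> / \<alpha> * (1 - c1) / (K / \<alpha>) = \<mu> * (1 - c1) / K"
        using \<alpha>(1) by simp
      have "?F \<alpha> (guarded_newton_step c1 (?F \<alpha>) v) \<le> ?F \<alpha> v - c1 *
          min 1 (\<mu> / \<alpha> * (1 - c1) / (K / \<alpha>)) *
          \<bar>newton_direction (?F \<alpha>) v \<bullet> gradient (?F \<alpha>) v\<bar>"
      proof (rule guarded_newton_step_decrease[OF GDERIV_smoothed_objective[OF \<alpha>(1)]
            smoothed_gradient_has_derivative[OF \<alpha>(1)]])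
        show "?F \<alpha> (v + p) \<le> ?F \<alpha> v + p \<bullet> smoothed_gradient N x y l \<alpha> v + K / \<alpha> / 2 * (norm p)\<^sup>2" for p
          unfolding K_def by (rule smoothed_objective_below_parabola[OF \<alpha> l_nonneg labels])
      qed (use \<mu>(1) \<mu>(2)[OF \<alpha>(1) near] K \<alpha> c1 in auto)
      moreover have "\<epsilon> * \<alpha> \<le> c1 * min 1 (\<mu> * (1 - c1) / K) *
          \<bar>newton_direction (?F \<alpha>) v \<bullet> gradient (?F \<alpha>) v\<bar>"
        unfolding \<epsilon>_def mult.assoc[of _ \<eta> \<alpha>] using go c1 \<mu>(1) K
        by (intro mult_left_mono) (auto simp: stopping_criterion_def)
      ultimately show ?thesis
        unfolding ratio by linarith
    qed
    show "?f wstar \<le> ?F \<alpha> v" for v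
      using c(2)[of v] c(1) hinge_le_smoothed_objective[OF \<alpha>(1), of N x y l v]
      by (smt (verit) mult_nonneg_nonneg norm_ge_zero)
    show "0 < \<epsilon> * \<alpha>"
      using \<epsilon> \<alpha>(1) by simp
    show "?F \<alpha> w - ?f wstar < real n * (\<epsilon> * \<alpha>)"
      using start mult_strict_right_mono[OF n \<alpha>(1)] by (simp add: mult.assoc)
  qed
  then show ?thesis
    by blast
qed

end


section \<open>The number of Newton steps per smoothing parameter\<close>

theorem lemma3p8:
  fixes N :: nat
    and x :: "nat \<Rightarrow> real^'m"
    and y :: "nat \<Rightarrow> real"
    and lambda :: real
    and wstar winit :: "real^'m"
    and I :: "nat set"
    and \<theta> :: "nat \<Rightarrow> real"
    and \<beta> c1 \<alpha>init :: real
  assumes labels: "\<And>i. i \<in> {1..N} \<Longrightarrow> y i \<in> {-1, 1}"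
    and lambda: "lambda \<ge> 0"
    and minimizer: "\<And>w. hinge_objective N x y lambda wstar \<le> hinge_objective N x y lambda w"
    and I_def: "I = {i \<in> {1..N}. 1 = y i * (x i \<bullet> wstar)}"
    and card_I: "card I = CARD('m)"
    and lin_indep: "inj_on x I" "independent (x ` I)"
    and theta_solves:
      "(\<Sum>i\<in>I. (\<theta> i * y i) *\<^sub>R x i)
         + (\<Sum>j\<in>{j \<in> {1..N}. j \<notin> I \<and> 1 > y j * (x j \<bullet> wstar)}. y j *\<^sub>R x j)
         - (real N * lambda) *\<^sub>R wstar = 0"
    and theta_bounds: "\<And>i. i \<in> I \<Longrightarrow> 0 < \<theta> i \<and> \<theta> i < 1"
    and beta: "0 < \<beta>" "\<beta> < 1"
    and c1: "0 < c1" "c1 < 1"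
    and alpha_init: "0 < \<alpha>init"
  shows "\<exists>\<eta>0>0. \<forall>\<eta>. 0 < \<eta> \<and> \<eta> < \<eta>0 \<longrightarrow>
           (\<exists>\<alpha>bar>0. \<exists>n. \<forall>k\<ge>1. \<beta> ^ k * \<alpha>init \<le> \<alpha>bar \<longrightarrow>
              stops_within (smoothed_objective N x y lambda) \<beta> c1 \<eta> (\<alpha>init, winit)
                (\<beta> ^ k * \<alpha>init) n)"
proof -
  interpret nondegenerate_vertex N x y lambda wstar I \<theta>
    using labels lambda I_def card_I lin_indep theta_solves theta_bounds by unfold_locales
  let ?F = "smoothed_objective N x y lambda"
  obtain \<eta>0 R where \<eta>0: "\<eta>0 > 0" and
    near: "\<And>\<eta> \<alpha> w. \<eta> < \<eta>0 \<Longrightarrow> 0 < \<alpha> \<Longrightarrow> \<alpha> \<le> \<alpha>init \<Longrightarrow> stopping_criterion ?F \<eta> (\<alpha>, w) \<Longrightarrow>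
      norm (w - wstar) \<le> R * \<alpha>"
    using stopping_criterion_near_vertex[OF alpha_init] by blast
  have "\<exists>\<alpha>bar>0. \<exists>n. \<forall>k\<ge>1. \<beta> ^ k * \<alpha>init \<le> \<alpha>bar \<longrightarrow>
       stops_within ?F \<beta> c1 \<eta> (\<alpha>init, winit) (\<beta> ^ k * \<alpha>init) n" if \<eta>: "0 < \<eta>" "\<eta> < \<eta>0" for \<eta>
  proof -
    obtain n0 where "stage_ends_within ?F \<beta> c1 \<eta> \<alpha>init winit n0"
      using stage_ends_uniformly[OF alpha_init \<eta>(1) c1, of "norm (winit - wstar) / \<alpha>init" \<beta>]
        alpha_init by fastforce
    moreover obtain n where n: "\<And>\<alpha> w. 0 < \<alpha> \<Longrightarrow> \<alpha> \<le> \<alpha>init \<Longrightarrow> norm (w - wstar) \<le> R / \<beta> * \<alpha> \<Longrightarrow>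
        stage_ends_within ?F \<beta> c1 \<eta> \<alpha> w n"
      using stage_ends_uniformly[OF alpha_init \<eta>(1) c1, of "R / \<beta>" \<beta>] by blast
    have "stage_ends_within ?F \<beta> c1 \<eta> (\<beta> ^ Suc k * \<alpha>init) w n"
      if "stopping_criterion ?F \<eta> (\<beta> ^ k * \<alpha>init, w)" for k w
    proof (rule n)
      have pos: "0 < \<beta> ^ k * \<alpha>init" and le: "\<And>k. \<beta> ^ k * \<alpha>init \<le> \<alpha>init"
        using beta alpha_init by (simp_all add: power_le_one)
      show "0 < \<beta> ^ Suc k * \<alpha>init"
        using beta alpha_init by simp
      show "\<beta> ^ Suc k * \<alpha>init \<le> \<alpha>init"
        by (rule le)
      show "norm (w - wstar) \<le> R / \<beta> * (\<beta> ^ Suc k * \<alpha>init)"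
        using near[OF \<eta>(2) pos le that] beta by simp
    qed
    ultimately have "stops_within ?F \<beta> c1 \<eta> (\<alpha>init, winit) (\<beta> ^ k * \<alpha>init) n" if "1 \<le> k" for k
      using stops_within_if_stages_end[OF beta alpha_init] that by blast
    then show ?thesis
      by (intro exI[of _ \<alpha>init] exI[of _ n] conjI alpha_init) simp
  qed
  then show ?thesis
    by (intro exI[of _ \<eta>0] conjI \<eta>0) simp
qed

end
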